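(* Let $q$ be a prime power. Then there exists a strongly regular graph that is cospectral with the collinearity graph of the Hermitian generalized quadrangle $H(3,q^2)$ and that is not geometric.
   Context: A generalized quadrangle of order $(s,t)$, $\mathrm{GQ}(s,t)$, is a point-line incidence structure such that each point is incident with $t+1$ lines and two distinct points are incident with at most one common line; each line is incident with $s+1$ points and two distinct lines are incident with at most one common point; and for every point $x$ and line $L$ not incident with $x$ there is a unique pair $(y,M)$ such that $M$ is incident with both $x$ and $y$, and $y$ is incident with $L$. Its collinearity graph (point graph) has the points as vertices, two distinct points being adjacent if some line is incident with both. The Hermitian generalized quadrangle $H(3,q^2)$ is the generalized quadrangle of order $(q^2,q)$ formed by the points and the lines contained in a nonsingular Hermitian variety of the projective space $\mathrm{PG}(3,q^2)$. Two graphs are cospectral if their adjacency matrices have the same spectrum. A strongly regular graph is geometric if it is the point graph of a partial geometry $\mathrm{pg}(s,t,\alpha)$, i.e. of a partial linear space with $s+1$ points on each line, $t+1$ lines through each point, such that for every point $x$ and line $L$ not incident with $x$ exactly $\alpha\geq 1$ points of $L$ are collinear with $x$ (a $\mathrm{GQ}(s,t)$ is a $\mathrm{pg}(s,t,1)$). *)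

theory Defs
  imports
    "HOL-Analysis.Cartesian_Space"
    "HOL-Number_Theory.Prime_Powers"
    "Jordan_Normal_Form.Char_Poly"
    "Graph_Theory.Pair_Digraph"
begin

hide_type (open) Matrix.vec
no_notation Matrix.vec_index (infixl \<open>$\<close> 100)

section \<open>Graphs\<close>

text \<open>A finite simple graph is a \<open>pair_graph\<close>: finite, loopless, with a symmetric arc relation.\<close>

definition nbrs :: "'v pair_pre_digraph \<Rightarrow> 'v \<Rightarrow> 'v set" where
  "nbrs G x = {y \<in> pverts G. (x, y) \<in> parcs G}"

text \<open>The inequalities exclude the edgeless and the complete graphs, as usual.\<close>

definition srg :: "'v pair_pre_digraph \<Rightarrow> nat \<Rightarrow> nat \<Rightarrow> nat \<Rightarrow> nat \<Rightarrow> bool" where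
  "srg G v k l m \<longleftrightarrow>
     pair_graph G \<and> card (pverts G) = v \<and> 0 < k \<and> k + 1 < v \<and>
     (\<forall>x\<in>pverts G. card (nbrs G x) = k) \<and>
     (\<forall>x\<in>pverts G. \<forall>y\<in>pverts G. x \<noteq> y \<longrightarrow>
        card (nbrs G x \<inter> nbrs G y) = (if (x, y) \<in> parcs G then l else m))"

definition strongly_regular :: "'v pair_pre_digraph \<Rightarrow> bool" where
  "strongly_regular G \<longleftrightarrow> (\<exists>v k l m. srg G v k l m)"

definition adj_mat :: "'v pair_pre_digraph \<Rightarrow> 'v list \<Rightarrow> complex mat" where
  "adj_mat G vs = mat (length vs) (length vs)
     (\<lambda>(i, j). if (vs ! i, vs ! j) \<in> parcs G then 1 else 0)"

text \<open>The spectrum of a matrix as a multiset: eigenvalues with algebraic multiplicity.\<close>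

definition spectrum_mset :: "complex mat \<Rightarrow> complex multiset" where
  "spectrum_mset M = proots (char_poly M)"

text \<open>The spectrum does not depend on the order in which the vertices are listed, since
  different orders give adjacency matrices that are conjugate by a permutation matrix.\<close>

definition cospectral :: "'v pair_pre_digraph \<Rightarrow> 'w pair_pre_digraph \<Rightarrow> bool" where
  "cospectral G H \<longleftrightarrow>
     (\<exists>vs ws. distinct vs \<and> set vs = pverts G \<and> distinct ws \<and> set ws = pverts H \<and>
        spectrum_mset (adj_mat G vs) = spectrum_mset (adj_mat H ws))"

section \<open>Point-line geometries\<close>

record ('p, 'l) incidence_structure =
  pts :: "'p set"
  lns :: "'l set"
  inc :: "'p \<Rightarrow> 'l \<Rightarrow> bool"

definition collinear_in :: "('p, 'l) incidence_structure \<Rightarrow> 'p \<Rightarrow> 'p \<Rightarrow> bool" where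
  "collinear_in D x y \<longleftrightarrow> (\<exists>L\<in>lns D. inc D x L \<and> inc D y L)"

definition collinearity_graph :: "('p, 'l) incidence_structure \<Rightarrow> 'p pair_pre_digraph" where
  "collinearity_graph D =
     \<lparr> pverts = pts D,
       parcs = {(x, y). x \<in> pts D \<and> y \<in> pts D \<and> x \<noteq> y \<and> collinear_in D x y} \<rparr>"

definition partial_linear_space :: "('p, 'l) incidence_structure \<Rightarrow> bool" where
  "partial_linear_space D \<longleftrightarrow>
     (\<forall>x\<in>pts D. \<forall>y\<in>pts D. \<forall>L\<in>lns D. \<forall>M\<in>lns D.
        inc D x L \<and> inc D y L \<and> inc D x M \<and> inc D y M \<longrightarrow> x = y \<or> L = M)"

definition partial_geometry ::
    "nat \<Rightarrow> nat \<Rightarrow> nat \<Rightarrow> ('p, 'l) incidence_structure \<Rightarrow> bool" where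
  "partial_geometry s t \<alpha> D \<longleftrightarrow>
     partial_linear_space D \<and> 1 \<le> \<alpha> \<and>
     (\<forall>L\<in>lns D. card {x \<in> pts D. inc D x L} = s + 1) \<and>
     (\<forall>x\<in>pts D. card {L \<in> lns D. inc D x L} = t + 1) \<and>
     (\<forall>x\<in>pts D. \<forall>L\<in>lns D. \<not> inc D x L \<longrightarrow>
        card {y \<in> pts D. inc D y L \<and> collinear_in D x y} = \<alpha>)"

text \<open>A partial geometry with finitely many points has finitely many lines, so labelling the
  lines by natural numbers is no restriction.  The points may be taken to be the vertices
  themselves, as incidence structures can be transported along graph isomorphisms.\<close>

definition geometric :: "'v pair_pre_digraph \<Rightarrow> bool" where
  "geometric G \<longleftrightarrow>
     (\<exists>(D :: ('v, nat) incidence_structure) s t \<alpha>.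
        partial_geometry s t \<alpha> D \<and> collinearity_graph D = G)"

section \<open>The Hermitian generalized quadrangle\<close>

text \<open>Over a field with \<open>q\<^sup>2\<close> elements, \<open>x \<mapsto> x ^ q\<close> is the involutory automorphism.\<close>

definition hermitian_matrix :: "nat \<Rightarrow> 'a::field^'n^'n \<Rightarrow> bool" where
  "hermitian_matrix q A \<longleftrightarrow> (\<forall>i j. A $ j $ i = (A $ i $ j) ^ q)"

definition hermitian_form :: "nat \<Rightarrow> 'a::field^'n^'n \<Rightarrow> 'a^'n \<Rightarrow> 'a^'n \<Rightarrow> 'a" where
  "hermitian_form q A u v = (\<Sum>i\<in>UNIV. \<Sum>j\<in>UNIV. A $ i $ j * u $ i * (v $ j) ^ q)"

text \<open>A point or line of the projective space is a subspace of dimension 1 or 2; it is contained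
  in the Hermitian variety iff all its vectors are isotropic.\<close>

definition hermitian_cone :: "nat \<Rightarrow> 'a::field^'n^'n \<Rightarrow> ('a^'n) set" where
  "hermitian_cone q A = {v. hermitian_form q A v v = 0}"

definition hermitian_GQ ::
    "nat \<Rightarrow> 'a::field^4^4 \<Rightarrow> (('a^4) set, ('a^4) set) incidence_structure" where
  "hermitian_GQ q A =
     \<lparr> pts = {P. vec.subspace P \<and> vec.dim P = 1 \<and> P \<subseteq> hermitian_cone q A},
       lns = {L. vec.subspace L \<and> vec.dim L = 2 \<and> L \<subseteq> hermitian_cone q A},
       inc = (\<subseteq>) \<rparr>"

end

theory Submission
  imports Defs "Jordan_Normal_Form.Schur_Decomposition"
begin

text \<open>
  Let \<open>K\<close> be the field with \<open>q\<^sup>2\<close> elements, with involution \<open>cj x = x ^ q\<close> and fixed field \<open>F\<close>.  Seen from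
  one of its points \<open>p\<close>, the quadrangle \<open>H(3,q\<^sup>2)\<close> has a layered description.  The points that are
  not collinear with \<open>p\<close> project onto the \<open>q\<^sup>4\<close> points of the affine plane \<open>K\<^sup>2\<close>, with \<open>q\<close> points
  (``heights'') in each fibre, and two of them that lie over \<open>a \<noteq> b\<close> can be collinear only if \<open>a - b\<close> is
  isotropic for the form \<open>x * cj y - y * cj x\<close>, that is, proportional over \<open>K\<close> to a vector of \<open>F\<^sup>2\<close>.
  These isotropic directions form a Baer subline with \<open>q + 1\<close> elements, and the points \<open>\<noteq> p\<close> that are
  collinear with \<open>p\<close> correspond to the affine lines in these directions; such a point is collinear
  with exactly the points above its line.

  For strong regularity of the collinearity graph, only this matters about the affine lines: they
  form a net of degree \<open>q + 1\<close> on \<open>K\<^sup>2\<close> in which two points are joined iff their difference is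
  isotropic.  Any such net, with the adjacencies inside the fibred part kept as they are, gives a
  strongly regular graph with the same parameters (theorem \<open>srg_net_graph\<close>).

  There is a second net of this kind.  Over \<open>F\<close>, the plane \<open>K\<^sup>2\<close> is the space of \<open>2 \<times> 2\<close> matrices (its
  columns are the coordinates of \<open>x\<close> and \<open>y\<close> in a basis \<open>1, \<theta>\<close> of \<open>K\<close>), and isotropic vectors are the
  matrices of rank at most one.  Transposition preserves the rank of differences, but it interchanges
  the two families of maximal cliques, so the transposed lines form a different net.
  In its graph, take a new neighbour \<open>u\<close> of \<open>p\<close> and a point \<open>v\<close> above the line of \<open>u\<close>.  The other points
  above this line that are adjacent to \<open>v\<close> lie in several isotropic directions from \<open>v\<close>, and two of
  them in different directions are not adjacent, for otherwise they would form a triangle with \<open>v\<close>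
  in the quadrangle.  So the common neighbours of the adjacent vertices \<open>u\<close> and \<open>v\<close> do not form a clique.
  But in a geometric graph with the parameters of a \<open>GQ(s,t)\<close> the partial geometry must itself be a
  \<open>GQ(s,t)\<close>, and then the common neighbours of two adjacent points are the rest of the line through
  them (lemma \<open>geometric_imp_common_nbrs_adjacent\<close>).

  Finally, the powers of the adjacency matrix of a strongly regular graph have traces that depend only
  on the parameters, so that equal parameters imply equal spectra
  (theorem \<open>cospectral_if_srg_parameters_eq\<close>).
\<close>

section \<open>Strongly regular graphs with equal parameters are cospectral\<close>

text \<open>In characteristic zero the power sums give the sum of \<open>p\<close> over the
  entries of the list for every polynomial \<open>p\<close>; a polynomial that vanishes at all
  entries except \<open>c\<close> isolates the multiplicity of \<open>c\<close>.\<close>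

lemma mset_eq_if_power_sums_eq:
  fixes xs ys :: "'a::field_char_0 list"
  assumes "\<And>n. (\<Sum>x\<leftarrow>xs. x ^ n) = (\<Sum>y\<leftarrow>ys. y ^ n)"
  shows "mset xs = mset ys"
proof (rule multiset_eqI)
  fix c
  have poly_sum: "(\<Sum>x\<leftarrow>zs. poly p x) = (\<Sum>i\<le>degree p. coeff p i * (\<Sum>x\<leftarrow>zs. x ^ i))" 
    for p and zs :: "'a list"
    by (induction zs) (auto simp: poly_altdef sum.distrib algebra_simps)
  define D where "D = (set xs \<union> set ys) - {c}"
  define p where "p = (\<Prod>d\<in>D. [:- d, 1:])"
  have p0: "poly p x = 0" if "x \<in> D" for x
    using that by (auto simp: p_def poly_prod D_def)
  have pc: "poly p c \<noteq> 0"
    by (auto simp: p_def poly_prod D_def)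
  have count: "(\<Sum>x\<leftarrow>zs. poly p x) = of_nat (count (mset zs) c) * poly p c" 
    if "set zs \<subseteq> insert c D" for zs
    using that by (induction zs) (auto simp: p0 algebra_simps)
  have "(\<Sum>x\<leftarrow>xs. poly p x) = (\<Sum>y\<leftarrow>ys. poly p y)"
    by (simp add: poly_sum assms)
  hence "of_nat (count (mset xs) c) * poly p c = of_nat (count (mset ys) c) * poly p c"
    by (subst (asm) (1 2) count) (auto simp: D_def)
  thus "count (mset xs) c = count (mset ys) c"
    using pc by simp
qed

definition mat_trace :: "'a::comm_semiring_0 mat \<Rightarrow> 'a" where
  "mat_trace M = (\<Sum>i<dim_row M. M $$ (i, i))"

lemma mat_trace_mult_commute:
  assumes "M \<in> carrier_mat n n" "N \<in> carrier_mat n n"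
  shows "mat_trace (M * N) = mat_trace (N * M)"
proof -
  have "mat_trace (M * N) = (\<Sum>i<n. \<Sum>j<n. M $$ (i, j) * N $$ (j, i))"
    using assms by (simp add: mat_trace_def scalar_prod_def lessThan_atLeast0)
  also have "\<dots> = (\<Sum>j<n. \<Sum>i<n. N $$ (j, i) * M $$ (i, j))"
    by (subst sum.swap) (simp add: mult.commute)
  also have "\<dots> = mat_trace (N * M)"
    using assms by (simp add: mat_trace_def scalar_prod_def lessThan_atLeast0)
  finally show ?thesis .
qed

lemma upper_triangular_mult:
  fixes M N :: "'a::comm_semiring_1 mat"
  assumes M: "M \<in> carrier_mat n n" and N: "N \<in> carrier_mat n n" 
    and "upper_triangular M" "upper_triangular N"
  shows "upper_triangular (M * N)"
    and "i < n \<Longrightarrow> (M * N) $$ (i, i) = M $$ (i, i) * N $$ (i, i)"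
proof -
  have M0: "M $$ (i, j) = 0" if "j < i" "i < n" for i j
    using assms that by (auto simp: upper_triangular_def)
  have N0: "N $$ (i, j) = 0" if "j < i" "i < n" for i j
    using assms that by (auto simp: upper_triangular_def)
  have entry: "(M * N) $$ (i, j) = (\<Sum>k<n. M $$ (i, k) * N $$ (k, j))" if "i < n" "j < n" for i j
    using M N that by (simp add: scalar_prod_def lessThan_atLeast0)
  show "upper_triangular (M * N)"
  proof
    fix i j assume ij: "j < i" "i < dim_row (M * N)"
    have "M $$ (i, k) * N $$ (k, j) = 0" if "k < n" for k
      using ij that M M0[of k i] N0[of j k] by (cases "k < i") auto
    thus "(M * N) $$ (i, j) = 0"
      using ij M by (subst entry) auto
  qed
  assume i: "i < n"
  have "M $$ (i, k) * N $$ (k, i) = 0" if "k < n" "k \<noteq> i" for k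
    using i that M0[of k i] N0[of i k] by (cases "k < i") auto
  hence "(\<Sum>k<n. M $$ (i, k) * N $$ (k, i)) = (\<Sum>k\<in>{i}. M $$ (i, k) * N $$ (k, i))"
    by (intro sum.mono_neutral_right) (use i in auto)
  thus "(M * N) $$ (i, i) = M $$ (i, i) * N $$ (i, i)"
    using i by (simp add: entry)
qed

lemma upper_triangular_pow:
  fixes M :: "'a::comm_semiring_1 mat"
  assumes M: "M \<in> carrier_mat n n" and ut: "upper_triangular M"
  shows "upper_triangular (M ^\<^sub>m k) \<and> (\<forall>i<n. (M ^\<^sub>m k) $$ (i, i) = (M $$ (i, i)) ^ k)"
proof (induction k)
  case 0
  thus ?case using M by auto
next
  case (Suc k)
  have "M ^\<^sub>m k \<in> carrier_mat n n" using M by (rule pow_carrier_mat)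
  with Suc show ?case 
    using upper_triangular_mult[of "M ^\<^sub>m k" n M] M ut by (auto simp: mult.commute)
qed

text \<open>By the Schur decomposition the matrix is similar to a triangular one with the
  eigenvalues on the diagonal.\<close>

lemma mat_trace_pow:
  fixes M :: "complex mat"
  assumes M: "M \<in> carrier_mat n n" and cp: "char_poly M = (\<Prod>a\<leftarrow>as. [:- a, 1:])"
  shows "mat_trace (M ^\<^sub>m k) = (\<Sum>a\<leftarrow>as. a ^ k)"
proof -
  obtain T P Q where schur: "schur_decomposition M as = (T, P, Q)"
    by (cases "schur_decomposition M as") auto
  have sim: "similar_mat_wit M T P Q" and ut: "upper_triangular T" and diag: "diag_mat T = as"
    using schur_decomposition[OF M cp schur] by auto
  note wit = similar_mat_witD2[OF M sim]
  have Tk: "T ^\<^sub>m k \<in> carrier_mat n n" using wit by (intro pow_carrier_mat)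
  have "mat_trace (M ^\<^sub>m k) = mat_trace ((P * T ^\<^sub>m k) * Q)"
    by (simp add: similar_mat_wit_pow_id[OF sim])
  also have "\<dots> = mat_trace (Q * (P * T ^\<^sub>m k))"
    by (rule mat_trace_mult_commute) (use wit Tk in auto)
  also have "Q * (P * T ^\<^sub>m k) = (Q * P) * T ^\<^sub>m k"
    by (rule assoc_mult_mat[symmetric]) (use wit Tk in auto)
  also have "\<dots> = T ^\<^sub>m k"
    using left_mult_one_mat[OF Tk] by (simp only: wit)
  also have "mat_trace \<dots> = (\<Sum>i<n. (T $$ (i, i)) ^ k)"
    using upper_triangular_pow[of T n k] ut wit Tk by (simp add: mat_trace_def)
  also have "\<dots> = (\<Sum>a\<leftarrow>diag_mat T. a ^ k)"
    using wit by (simp add: diag_mat_def sum_list_distinct_conv_sum_set comp_def lessThan_atLeast0)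
  finally show ?thesis by (simp add: diag)
qed

lemma spectrum_mset_eq_if_traces_eq:
  fixes M N :: "complex mat"
  assumes M: "M \<in> carrier_mat n n" and N: "N \<in> carrier_mat n n"
    and traces: "\<And>k. mat_trace (M ^\<^sub>m k) = mat_trace (N ^\<^sub>m k)"
  shows "spectrum_mset M = spectrum_mset N"
proof -
  obtain as where as: "char_poly M = (\<Prod>a\<leftarrow>as. [:- a, 1:])"
    using char_poly_factorized[OF M] by blast
  obtain bs where bs: "char_poly N = (\<Prod>a\<leftarrow>bs. [:- a, 1:])"
    using char_poly_factorized[OF N] by blast
  have "mset as = mset bs"
    using traces by (intro mset_eq_if_power_sums_eq) (simp add: mat_trace_pow[OF M as] mat_trace_pow[OF N bs])
  hence "char_poly M = char_poly N"
    unfolding as bs by (metis mset_map prod_mset_prod_list)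
  thus ?thesis by (simp add: spectrum_mset_def)
qed

definition all_ones_mat :: "nat \<Rightarrow> complex mat" where
  "all_ones_mat n = mat n n (\<lambda>_. 1)"

lemma sum_positions_indicator:
  fixes vs :: "'v list"
  assumes "distinct vs"
  shows "(\<Sum>i<length vs. if P (vs ! i) then 1 else 0 :: complex) = of_nat (card {x \<in> set vs. P x})"
proof -
  have "(\<Sum>i<length vs. if P (vs ! i) then 1 else 0 :: complex) = (\<Sum>x\<in>set vs. if P x then 1 else 0)"
    by (rule sum.reindex_bij_betw) (use bij_betw_nth[OF assms] in \<open>auto simp: bij_betw_def\<close>)
  thus ?thesis by (simp add: sum.If_cases Int_def)
qed

lemma srg_sym: "srg G v k l m \<Longrightarrow> (x, y) \<in> parcs G \<Longrightarrow> (y, x) \<in> parcs G"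
  by (auto simp: srg_def pair_graph_def pair_pseudo_graph_def pair_sym_digraph_def
      pair_sym_digraph_axioms_def symmetric_def sym_def)

lemma srg_no_loop: "srg G v k l m \<Longrightarrow> (x, x) \<notin> parcs G"
  by (auto simp: srg_def pair_graph_def pair_digraph_def pair_loopfree_digraph_def
      pair_loopfree_digraph_axioms_def)

lemma adj_mat_carrier: "adj_mat G vs \<in> carrier_mat (length vs) (length vs)"
  by (simp add: adj_mat_def)

text \<open>The entry counts the common neighbours of two vertices; this is the matrix form
  \<open>A\<^sup>2 = k I + l A + m (J - I - A)\<close> of strong regularity.\<close>

lemma srg_adj_mat_square:
  assumes G: "srg G v k l m" and vs: "distinct vs" "set vs = pverts G"
  shows "i < length vs \<Longrightarrow> j < length vs \<Longrightarrow> (adj_mat G vs * adj_mat G vs) $$ (i, j) =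
     (of_nat k - of_nat m) * (if i = j then 1 else 0) 
     + (of_nat l - of_nat m) * adj_mat G vs $$ (i, j) + of_nat m"
proof -
  assume ij: "i < length vs" "j < length vs"
  let ?x = "vs ! i" and ?y = "vs ! j"
  have mem: "?x \<in> pverts G" "?y \<in> pverts G" using vs ij nth_mem by blast+
  have "(adj_mat G vs * adj_mat G vs) $$ (i, j) = 
     (\<Sum>h<length vs. if (?x, vs ! h) \<in> parcs G \<and> (?y, vs ! h) \<in> parcs G then 1 else 0)"
    using ij srg_sym[OF G] 
    by (auto simp: adj_mat_def scalar_prod_def lessThan_atLeast0 intro!: sum.cong)
  also have "\<dots> = of_nat (card (nbrs G ?x \<inter> nbrs G ?y))"
    by (subst sum_positions_indicator[OF vs(1), where P = "\<lambda>z. (?x, z) \<in> parcs G \<and> (?y, z) \<in> parcs G"])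
       (auto simp: nbrs_def vs intro!: arg_cong[where f = card])
  finally show ?thesis
    using G mem ij srg_no_loop[OF G] vs nth_eq_iff_index_eq[OF vs(1)] 
    by (auto simp: srg_def adj_mat_def)
qed

lemma srg_ones_mult_adj_mat:
  assumes G: "srg G v k l m" and vs: "distinct vs" "set vs = pverts G"
  shows "i < length vs \<Longrightarrow> j < length vs \<Longrightarrow> 
     (all_ones_mat (length vs) * adj_mat G vs) $$ (i, j) = of_nat k"
proof -
  assume ij: "i < length vs" "j < length vs"
  have "(all_ones_mat (length vs) * adj_mat G vs) $$ (i, j) =
     (\<Sum>h<length vs. if (vs ! j, vs ! h) \<in> parcs G then 1 else 0)"
    using ij srg_sym[OF G] 
    by (auto simp: adj_mat_def all_ones_mat_def scalar_prod_def lessThan_atLeast0 intro!: sum.cong)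
  also have "\<dots> = of_nat (card (nbrs G (vs ! j)))"
    by (subst sum_positions_indicator[OF vs(1), where P = "\<lambda>z. (vs ! j, z) \<in> parcs G"])
       (auto simp: nbrs_def vs intro!: arg_cong[where f = card])
  finally show ?thesis
    using G ij vs nth_mem[of j vs] by (auto simp: srg_def)
qed

text \<open>The span of \<open>I\<close>, \<open>A\<close> and \<open>J\<close> is closed under multiplication by \<open>A\<close>, with structure constants that are
  functions of the parameters.  Both graphs are treated together in order to express that the
  coefficients are the same for them.\<close>

lemma srg_adj_mat_pow:
  assumes "srg G v k l m" "distinct vs" "set vs = pverts G"
    and "srg H v k l m" "distinct ws" "set ws = pverts H"
  shows "\<exists>\<alpha> \<beta> \<gamma>. 
     (\<forall>i<v. \<forall>j<v. (adj_mat G vs ^\<^sub>m n) $$ (i, j) = 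
        \<alpha> * (if i = j then 1 else 0) + \<beta> * adj_mat G vs $$ (i, j) + \<gamma>) \<and>
     (\<forall>i<v. \<forall>j<v. (adj_mat H ws ^\<^sub>m n) $$ (i, j) = 
        \<alpha> * (if i = j then 1 else 0) + \<beta> * adj_mat H ws $$ (i, j) + \<gamma>)"
proof (induction n)
  case 0
  have "length vs = v" "length ws = v"
    using assms by (auto simp: srg_def simp flip: distinct_card)
  thus ?case by (intro exI[of _ 1] exI[of _ 0]) (auto simp: adj_mat_def)
next
  case (Suc n)
  then obtain \<alpha> \<beta> \<gamma> where 
     IHG: "(\<forall>i<v. \<forall>j<v. (adj_mat G vs ^\<^sub>m n) $$ (i, j) = 
        \<alpha> * (if i = j then 1 else 0) + \<beta> * adj_mat G vs $$ (i, j) + \<gamma>)" and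
     IHH: "(\<forall>i<v. \<forall>j<v. (adj_mat H ws ^\<^sub>m n) $$ (i, j) = 
        \<alpha> * (if i = j then 1 else 0) + \<beta> * adj_mat H ws $$ (i, j) + \<gamma>)" by blast
  have step: "(adj_mat K us ^\<^sub>m Suc n) $$ (i, j) = 
        \<beta> * (of_nat k - of_nat m) * (if i = j then 1 else 0) + 
        (\<alpha> + \<beta> * (of_nat l - of_nat m)) * adj_mat K us $$ (i, j) + (\<beta> * of_nat m + \<gamma> * of_nat k)"
    if K: "srg K v k l m" and us: "distinct us" "set us = pverts K" and ij: "i < v" "j < v"
    and IH: "(\<forall>i<v. \<forall>j<v. (adj_mat K us ^\<^sub>m n) $$ (i, j) = 
        \<alpha> * (if i = j then 1 else 0) + \<beta> * adj_mat K us $$ (i, j) + \<gamma>)"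
    for K :: "'c pair_pre_digraph" and us i j
  proof -
    have len: "length us = v"
      using K us by (auto simp: srg_def simp flip: distinct_card)
    let ?A = "adj_mat K us"
    have A: "?A \<in> carrier_mat v v" using adj_mat_carrier[of K us] len by simp
    have An: "?A ^\<^sub>m n \<in> carrier_mat v v" by (rule pow_carrier_mat[OF A])
    have "(?A ^\<^sub>m Suc n) $$ (i, j) = (\<Sum>h<v. (?A ^\<^sub>m n) $$ (i, h) * ?A $$ (h, j))"
      using A An ij by (simp add: scalar_prod_def lessThan_atLeast0)
    also have "\<dots> = (\<Sum>h<v. (if i = h then \<alpha> * ?A $$ (h, j) else 0) 
        + \<beta> * (?A $$ (i, h) * ?A $$ (h, j)) + \<gamma> * (all_ones_mat v $$ (i, h) * ?A $$ (h, j)))"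
      using IH ij by (intro sum.cong) (auto simp: algebra_simps all_ones_mat_def)
    also have "\<dots> = \<alpha> * ?A $$ (i, j) + \<beta> * (?A * ?A) $$ (i, j) + \<gamma> * (all_ones_mat v * ?A) $$ (i, j)"
      using A ij by (simp add: sum.distrib scalar_prod_def lessThan_atLeast0 sum_distrib_left all_ones_mat_def)
    also have "\<dots> = \<beta> * (of_nat k - of_nat m) * (if i = j then 1 else 0) + 
        (\<alpha> + \<beta> * (of_nat l - of_nat m)) * ?A $$ (i, j) + (\<beta> * of_nat m + \<gamma> * of_nat k)"
    proof -
      have "(?A * ?A) $$ (i, j) = (of_nat k - of_nat m) * (if i = j then 1 else 0) 
          + (of_nat l - of_nat m) * ?A $$ (i, j) + of_nat m"
        using srg_adj_mat_square[OF K us, of i j] ij len by simp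
      moreover have "(all_ones_mat v * ?A) $$ (i, j) = of_nat k"
        using srg_ones_mult_adj_mat[OF K us, of i j] ij len by simp
      ultimately show ?thesis
        by (simp only:) (simp add: algebra_simps)
    qed
    finally show ?thesis .
  qed
  show ?case
    by (intro exI[of _ "\<beta> * (of_nat k - of_nat m)"] exI[of _ "\<alpha> + \<beta> * (of_nat l - of_nat m)"]
        exI[of _ "\<beta> * of_nat m + \<gamma> * of_nat k"] conjI allI impI step assms IHG IHH)
qed

theorem cospectral_if_srg_parameters_eq:
  assumes G: "srg G v k l m" and H: "srg H v k l m"
  shows "cospectral G H"
proof -
  have "finite (pverts G)" "finite (pverts H)"
    using G H by (auto simp: srg_def pair_graph_def pair_digraph_def pair_fin_digraph_def 
        pair_fin_digraph_axioms_def)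
  then obtain vs ws where vs: "distinct vs" "set vs = pverts G" and ws: "distinct ws" "set ws = pverts H"
    by (meson finite_distinct_list)
  have len: "length vs = v" "length ws = v"
    using G H vs ws by (auto simp: srg_def simp flip: distinct_card)
  have "mat_trace (adj_mat G vs ^\<^sub>m n) = mat_trace (adj_mat H ws ^\<^sub>m n)" for n
  proof -
    obtain \<alpha> \<beta> \<gamma> where
     "\<forall>i<v. \<forall>j<v. (adj_mat G vs ^\<^sub>m n) $$ (i, j) = 
        \<alpha> * (if i = j then 1 else 0) + \<beta> * adj_mat G vs $$ (i, j) + \<gamma>"
     "\<forall>i<v. \<forall>j<v. (adj_mat H ws ^\<^sub>m n) $$ (i, j) = 
        \<alpha> * (if i = j then 1 else 0) + \<beta> * adj_mat H ws $$ (i, j) + \<gamma>"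
      using srg_adj_mat_pow[OF G vs H ws, of n] by blast
    thus ?thesis
      using adj_mat_carrier[of G vs] adj_mat_carrier[of H ws] srg_no_loop[OF G] srg_no_loop[OF H]
      by (auto simp: mat_trace_def len adj_mat_def)
  qed
  hence "spectrum_mset (adj_mat G vs) = spectrum_mset (adj_mat H ws)"
    using adj_mat_carrier[of G vs] adj_mat_carrier[of H ws] len
    by (intro spectrum_mset_eq_if_traces_eq[of _ v]) auto
  thus ?thesis
    unfolding cospectral_def using vs ws by blast
qed

section \<open>Isomorphisms, and edges in geometric graphs\<close>

lemma pair_graphI:
  assumes "finite (pverts G)" "parcs G \<subseteq> pverts G \<times> pverts G" 
    and "\<And>x y. (x, y) \<in> parcs G \<Longrightarrow> (y, x) \<in> parcs G" "\<And>x. (x, x) \<notin> parcs G"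
  shows "pair_graph G"
proof -
  have "finite (parcs G)" using assms(1,2) by (meson finite_SigmaI finite_subset)
  thus ?thesis
    using assms by unfold_locales (auto simp: symmetric_def sym_def)
qed

lemma srg_finite: "srg G v k l m \<Longrightarrow> finite (pverts G)"
  by (auto simp: srg_def pair_graph_def pair_digraph_def pair_fin_digraph_def pair_fin_digraph_axioms_def)

lemma srg_isomorphic:
  assumes G: "srg G v k l m" and bij: "bij_betw f (pverts G) (pverts H)"
    and arcs: "parcs H \<subseteq> pverts H \<times> pverts H"
      "\<And>x y. x \<in> pverts G \<Longrightarrow> y \<in> pverts G \<Longrightarrow> (f x, f y) \<in> parcs H \<longleftrightarrow> (x, y) \<in> parcs G"
  shows "srg H v k l m"
proof -
  have inj: "inj_on f (pverts G)" and im: "pverts H = f ` pverts G"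
    using bij by (auto simp: bij_betw_def)
  have nbrs: "nbrs H (f x) = f ` nbrs G x" if "x \<in> pverts G" for x
    using that arcs by (auto simp: nbrs_def im)
  have sub: "nbrs G x \<subseteq> pverts G" for x by (auto simp: nbrs_def)
  have card_nbrs: "card (nbrs H (f x)) = card (nbrs G x)" if "x \<in> pverts G" for x
    using that nbrs inj sub by (metis card_image inj_on_subset)
  have "nbrs H (f x) \<inter> nbrs H (f y) = f ` (nbrs G x \<inter> nbrs G y)" 
    if "x \<in> pverts G" "y \<in> pverts G" for x y
    using that nbrs inj sub by (simp add: inj_on_image_Int)
  hence card_common: "card (nbrs H (f x) \<inter> nbrs H (f y)) = card (nbrs G x \<inter> nbrs G y)"
    if "x \<in> pverts G" "y \<in> pverts G" for x y
    using that inj sub by (metis card_image inj_on_subset le_infI1)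
  have "pair_graph H"
  proof (rule pair_graphI)
    show "finite (pverts H)" using srg_finite[OF G] by (simp add: im)
    show "parcs H \<subseteq> pverts H \<times> pverts H" by fact
    have preimage: "\<exists>a\<in>pverts G. \<exists>b\<in>pverts G. x = f a \<and> y = f b \<and> (a, b) \<in> parcs G" 
      if xy: "(x, y) \<in> parcs H" for x y
    proof -
      have "x \<in> f ` pverts G" "y \<in> f ` pverts G" using arcs(1) xy im by auto
      thus ?thesis using arcs(2) xy by auto
    qed
    show "(y, x) \<in> parcs H" if "(x, y) \<in> parcs H" for x y
      using preimage[OF that] arcs(2) srg_sym[OF G] by auto
    show "(x, x) \<notin> parcs H" for x
      using preimage[of x x] srg_no_loop[OF G] inj_on_eq_iff[OF inj] by auto
  qed
  moreover have "card (pverts H) = card (pverts G)" using inj by (simp add: im card_image)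
  moreover have "\<forall>x\<in>pverts H. card (nbrs H x) = k"
    using G card_nbrs by (simp add: im srg_def)
  moreover have "card (nbrs H x' \<inter> nbrs H y') = (if (x', y') \<in> parcs H then l else m)"
    if xy': "x' \<in> pverts H" "y' \<in> pverts H" "x' \<noteq> y'" for x' y'
  proof -
    obtain x y where xy: "x \<in> pverts G" "y \<in> pverts G" "x' = f x" "y' = f y"
      using xy' im by blast
    hence "x \<noteq> y" using xy' by blast
    thus ?thesis
      using G xy by (simp add: card_common arcs(2) srg_def)
  qed
  ultimately show ?thesis
    using G by (simp add: srg_def)
qed

definition line_pts :: "('p, 'l) incidence_structure \<Rightarrow> 'l \<Rightarrow> 'p set" where
  "line_pts D L = {x \<in> pts D. inc D x L}"

definition pencil :: "('p, 'l) incidence_structure \<Rightarrow> 'p \<Rightarrow> 'l set" where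
  "pencil D x = {L \<in> lns D. inc D x L}"

text \<open>Counting the neighbours of a point, the common neighbours of two noncollinear points,
  and the points on a line gives \<open>s (t + 1) = s' (t' + 1)\<close>, \<open>t + 1 = \<alpha>
  (t' + 1)\<close> and \<open>s' - 1 \<le> s - 1\<close>. The first two yield \<open>s' = s
  \<alpha>\<close>, so the third forces \<open>\<alpha> = 1\<close> and \<open>s' = s\<close>.
  Then the line through two adjacent points already contains all \<open>s - 1\<close> of their
  common neighbours.\<close>

lemma geometric_imp_common_nbrs_adjacent:
  assumes srg: "srg G v (s * (t + 1)) (s - 1) (t + 1)" and geo: "geometric G"
    and xy: "(x, y) \<in> parcs G" 
    and w: "w \<in> nbrs G x \<inter> nbrs G y" "w' \<in> nbrs G x \<inter> nbrs G y" "w \<noteq> w'"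
  shows "(w, w') \<in> parcs G"
proof -
  obtain D :: "('a, nat) incidence_structure" and s' t' \<alpha> where
    pg: "partial_geometry s' t' \<alpha> D" and D: "collinearity_graph D = G"
    using geo by (auto simp: geometric_def)
  have verts: "pverts G = pts D" and
    arcs: "(a, b) \<in> parcs G \<longleftrightarrow> a \<in> pts D \<and> b \<in> pts D \<and> a \<noteq> b \<and> (\<exists>L\<in>lns D. inc D a L \<and> inc D b L)" for a b
    by (auto simp: collinearity_graph_def collinear_in_def simp flip: D)
  have pls: "L = M" if "L \<in> lns D" "M \<in> lns D" "a \<in> line_pts D L" "b \<in> line_pts D L" 
    "a \<in> line_pts D M" "b \<in> line_pts D M" "a \<noteq> b" for a b L M
    using pg that by (auto simp: partial_geometry_def partial_linear_space_def line_pts_def)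
  have \<alpha>: "\<alpha> \<ge> 1" using pg by (simp add: partial_geometry_def)
  have card_line: "card (line_pts D L) = s' + 1" if "L \<in> lns D" for L
    using pg that by (simp add: partial_geometry_def line_pts_def)
  have fin_line: "finite (line_pts D L)" if "L \<in> lns D" for L
    using card_line[OF that] by (metis add_is_0 card.infinite one_neq_zero)
  have card_pencil: "card (pencil D a) = t' + 1" if "a \<in> pts D" for a
    using pg that by (simp add: partial_geometry_def pencil_def)
  have fin_pencil: "finite (pencil D a)" if "a \<in> pts D" for a
    using card_pencil[OF that] by (metis add_is_0 card.infinite one_neq_zero)
  have s: "0 < s" using srg by (auto simp: srg_def intro: Nat.gr0I)
  have degree: "s * (t + 1) = s' * (t' + 1)"
  proof -
    have x: "x \<in> pts D" using xy arcs by blast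
    have "nbrs G x = (\<Union>L\<in>pencil D x. line_pts D L - {x})"
      using x by (auto simp: nbrs_def arcs verts line_pts_def pencil_def)
    also have "card \<dots> = (\<Sum>L\<in>pencil D x. card (line_pts D L - {x}))"
    proof (rule card_UN_disjoint)
      show "\<forall>L\<in>pencil D x. \<forall>M\<in>pencil D x. L \<noteq> M \<longrightarrow> (line_pts D L - {x}) \<inter> (line_pts D M - {x}) = {}"
        using pls[of _ _ x] x by (auto simp: pencil_def line_pts_def)
    qed (use x fin_pencil fin_line in \<open>auto simp: pencil_def\<close>)
    also have "\<dots> = (\<Sum>L\<in>pencil D x. s')"
      by (intro sum.cong) (use x card_line fin_line in \<open>auto simp: pencil_def line_pts_def\<close>)
    also have "\<dots> = s' * (t' + 1)" using card_pencil[OF x] by simp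
    finally show ?thesis using srg x by (simp add: srg_def verts)
  qed
  have mu: "t + 1 = \<alpha> * (t' + 1)"
  proof -
    obtain a b where ab: "a \<in> pts D" "b \<in> pts D" "a \<noteq> b" "(a, b) \<notin> parcs G"
    proof -
      have x: "x \<in> pverts G" using xy arcs verts by blast
      have "card (insert x (nbrs G x)) \<le> card (nbrs G x) + 1"
        using srg_finite[OF srg] by (simp add: card_insert_if nbrs_def)
      also have "\<dots> < card (pverts G)" using srg x by (simp add: srg_def)
      finally have "\<not> pverts G \<subseteq> insert x (nbrs G x)"
        using card_mono[of "insert x (nbrs G x)" "pverts G"] srg_finite[OF srg] 
        by (auto simp: nbrs_def not_less)
      thus ?thesis using that x by (auto simp: nbrs_def verts)
    qed
    have nc: "\<not> inc D b L" if "L \<in> pencil D a" for L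
      using ab that arcs by (auto simp: pencil_def)
    have "nbrs G a \<inter> nbrs G b = (\<Union>L\<in>pencil D a. {z \<in> pts D. inc D z L \<and> collinear_in D b z})"
      using ab nc by (fastforce simp: nbrs_def arcs verts pencil_def collinear_in_def)
    also have "card \<dots> = (\<Sum>L\<in>pencil D a. card {z \<in> pts D. inc D z L \<and> collinear_in D b z})"
    proof (rule card_UN_disjoint)
      show "\<forall>L\<in>pencil D a. \<forall>M\<in>pencil D a. L \<noteq> M \<longrightarrow> 
        {z \<in> pts D. inc D z L \<and> collinear_in D b z} \<inter> {z \<in> pts D. inc D z M \<and> collinear_in D b z} = {}"
      proof (intro ballI impI)
        fix L M assume LM: "L \<in> pencil D a" "M \<in> pencil D a" "L \<noteq> M"
        have "z = a" if "z \<in> pts D" "inc D z L" "inc D z M" for z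
          using pls[of L M a z] LM that ab by (auto simp: pencil_def line_pts_def)
        moreover have "\<not> collinear_in D b a"
          using ab arcs by (auto simp: collinear_in_def)
        ultimately show "{z \<in> pts D. inc D z L \<and> collinear_in D b z} \<inter> {z \<in> pts D. inc D z M \<and> collinear_in D b z} = {}"
          by blast
      qed
      show "\<forall>L\<in>pencil D a. finite {z \<in> pts D. inc D z L \<and> collinear_in D b z}"
        using srg_finite[OF srg] by (simp add: verts)
    qed (use ab fin_pencil in auto)
    also have "\<dots> = (\<Sum>L\<in>pencil D a. \<alpha>)"
      by (intro sum.cong) (use pg ab nc in \<open>auto simp: partial_geometry_def pencil_def\<close>)
    also have "\<dots> = \<alpha> * (t' + 1)" using card_pencil ab by simp
    finally show ?thesis using srg ab by (simp add: srg_def verts)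
  qed
  \<comment> \<open>The line through the given edge supplies \<open>s' - 1\<close> common neighbours.\<close>
  obtain L where L: "L \<in> lns D" "inc D x L" "inc D y L" and xy': "x \<in> pts D" "y \<in> pts D" "x \<noteq> y"
    using xy arcs by blast
  have sub: "line_pts D L - {x, y} \<subseteq> nbrs G x \<inter> nbrs G y"
    using L xy' by (auto simp: nbrs_def arcs verts line_pts_def)
  have card_sub: "card (line_pts D L - {x, y}) = s' - 1"
    using L xy' card_line[OF L(1)] by (subst card_Diff_subset) (auto simp: line_pts_def)
  have common: "card (nbrs G x \<inter> nbrs G y) = s - 1" 
    using srg xy xy' by (simp add: srg_def verts)
  have fin: "finite (nbrs G x \<inter> nbrs G y)" using srg_finite[OF srg] by (simp add: nbrs_def)
  have "s' * (t' + 1) = s * (\<alpha> * (t' + 1))" by (simp only: degree[symmetric] mu)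
  also have "\<dots> = (s * \<alpha>) * (t' + 1)" by (rule mult.assoc[symmetric])
  finally have s'_eq: "s' = s * \<alpha>" by (metis add_gr_0 less_one mult_cancel2 not_less_zero)
  have "s' - 1 \<le> s - 1"
    using card_mono[OF fin sub] by (simp only: card_sub common)
  moreover have "s * 1 \<le> s * \<alpha>" using \<alpha> by (rule mult_le_mono2)
  ultimately have "s' = s" using s'_eq s by linarith
  hence "line_pts D L - {x, y} = nbrs G x \<inter> nbrs G y"
    by (intro card_subset_eq[OF fin sub]) (simp only: card_sub common)
  hence "w \<in> line_pts D L" "w' \<in> line_pts D L" using w by blast+
  thus ?thesis using w(3) L by (auto simp: arcs line_pts_def)
qed

section \<open>Fields of square order\<close>

lemma card_UNIV_eq_range_times_kernel:
  fixes f :: "'a::{ab_group_add,finite} \<Rightarrow> 'b::ab_group_add"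
  assumes add: "\<And>x y. f (x + y) = f x + f y"
  shows "CARD('a) = card (range f) * card {x. f x = 0}"
proof -
  have f0: "f 0 = 0" using add[of 0 0] by simp
  have fminus: "f (x - y) = f x - f y" for x y 
    using add[of "x - y" y] by (simp add: algebra_simps)
  have fibre: "card {x. f x = c} = card {x. f x = 0}" if c: "c \<in> range f" for c
  proof -
    obtain x0 where x0: "c = f x0" using c by blast
    show ?thesis
      by (rule bij_betw_same_card[of "\<lambda>x. x - x0"], 
          rule bij_betw_byWitness[where f' = "\<lambda>x. x + x0"]) (auto simp: fminus add x0)
  qed
  have "CARD('a) = card (\<Union>c\<in>range f. {x. f x = c})"
    by (rule arg_cong[where f = card]) auto
  also have "\<dots> = (\<Sum>c\<in>range f. card {x. f x = c})"
    by (rule card_UN_disjoint) auto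
  also have "\<dots> = card (range f) * card {x. f x = 0}"
    by (simp add: fibre)
  finally show ?thesis .
qed

lemma card_roots_trinomial_le:
  fixes a b :: "'a::idom"
  assumes "n > 1"
  shows "card {x. x ^ n + a * x + b = 0} \<le> n"
proof -
  let ?p = "Polynomial.monom 1 n + [:b, a:]"
  have deg: "degree ?p = n"
    using assms by (subst degree_add_eq_left) (auto simp: Polynomial.degree_monom_eq)
  hence "?p \<noteq> 0" using assms by auto
  hence "card {x. poly ?p x = 0} \<le> degree ?p" by (rule card_poly_roots_bound)
  thus ?thesis by (simp add: deg Polynomial.poly_monom algebra_simps)
qed

text \<open>The parameter \<open>K\<close> carries the type of the field, which \<open>q\<close>
  does not determine.\<close>

locale hermitian_field =
  fixes q :: nat and K :: "'a::{field,finite} itself"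
  assumes primepow_q: "primepow q" and card_field: "CARD('a) = q\<^sup>2"
begin

lemma q_gt_1: "q > 1"
  using primepow_q by (rule primepow_gt_Suc_0[unfolded One_nat_def[symmetric]])

definition cj :: "'a \<Rightarrow> 'a" where "cj x = x ^ q"

lemma cj_add: "cj (x + y) = cj x + cj y"
proof -
  obtain p k where p: "prime p" "k > 0" "q = p ^ k"
    using primepow_q by (auto simp: primepow_def)
  have char: "prime CHAR('a)"
    by (rule prime_CHAR_semidom) (simp add: finite_imp_CHAR_pos)
  \<comment> \<open>Translation by \<open>1\<close> permutes the field, so summing over the field shows \<open>q\<^sup>2 = 0\<close> in it.\<close>
  have "(\<Sum>x\<in>UNIV. x + 1 :: 'a) = (\<Sum>x\<in>UNIV. x)"
    by (rule sum.reindex_bij_witness[of _ "\<lambda>x. x - 1" "\<lambda>x. x + 1"]) auto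
  hence "of_nat CARD('a) = (0 :: 'a)" by (simp add: sum.distrib)
  hence "CHAR('a) dvd CARD('a)" by (simp only: of_nat_eq_0_iff_char_dvd)
  hence "CHAR('a) dvd p ^ (k * 2)" by (simp only: card_field p(3) power_mult)
  hence "CHAR('a) dvd p" using char prime_dvd_power by blast
  hence "CHAR('a) = p" using char p(1) by (simp add: primes_dvd_imp_eq)
  thus ?thesis
    unfolding cj_def using freshmans_dream'[OF char, of q k x y] p by simp
qed

lemma cj_mult: "cj (x * y) = cj x * cj y" 
  by (simp add: cj_def power_mult_distrib)

lemma cj_0 [simp]: "cj 0 = 0" and cj_1 [simp]: "cj 1 = 1"
  using q_gt_1 by (auto simp: cj_def)

lemma cj_minus: "cj (- x) = - cj x"
  using cj_add[of x "-x"] by (simp add: add_eq_0_iff)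

lemma cj_diff: "cj (x - y) = cj x - cj y"
  using cj_add[of x "-y"] by (simp add: cj_minus)

lemma cj_eq_0_iff [simp]: "cj x = 0 \<longleftrightarrow> x = 0"
  using q_gt_1 by (simp add: cj_def)

lemma cj_divide: "cj (x / y) = cj x / cj y"
  by (simp add: cj_def power_divide)

lemma cj_cj [simp]: "cj (cj x) = x"
proof (cases "x = 0")
  case False
  let ?U = "UNIV - {0 :: 'a}"
  have "(\<Prod>y\<in>?U. x * y) = (\<Prod>y\<in>?U. y)"
    by (rule prod.reindex_bij_witness[of _ "\<lambda>y. y / x" "\<lambda>y. x * y"]) (use False in auto)
  hence "x ^ card ?U = 1" by (simp add: prod.distrib)
  hence "x * x ^ (q\<^sup>2 - 1) = x" by (simp add: card_Diff_subset card_field)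
  hence "x ^ q\<^sup>2 = x"
    using q_gt_1 by (simp flip: power_Suc)
  thus ?thesis by (simp add: cj_def power2_eq_square flip: power_mult)
qed simp

lemmas cj_simps = cj_add cj_mult cj_minus cj_diff cj_divide

lemma cj_inject [simp]: "cj x = cj y \<longleftrightarrow> x = y"
  by (metis cj_cj)

definition fixed_field :: "'a set" where "fixed_field = {s. cj s = s}"

text \<open>The map \<open>x \<mapsto> x - cj x\<close> has kernel \<open>F\<close> and takes
  values among the skew elements. Each of these two sets consists of roots of a polynomial of
  degree \<open>q\<close>, and the product of the sizes of kernel and range is
  \<open>q\<^sup>2\<close>; hence all the bounds are attained.\<close>

lemma card_fixed_field: "card fixed_field = q"
  and range_minus_cj: "range (\<lambda>x. x - cj x) = {y. cj y = - y}"
  and card_skew: "card {y. cj y = - y} = q"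
proof -
  let ?R = "range (\<lambda>x. x - cj x)" and ?S = "{y. cj y = - y}"
  have "CARD('a) = card ?R * card {x. x - cj x = 0}"
    by (rule card_UNIV_eq_range_times_kernel) (simp add: cj_simps algebra_simps)
  also have "{x. x - cj x = 0} = fixed_field" by (auto simp: fixed_field_def)
  finally have prod: "card ?R * card fixed_field = q * q" by (simp add: card_field power2_eq_square)
  have F: "card fixed_field \<le> q"
    using card_roots_trinomial_le[OF q_gt_1, of "-1" "0::'a"] 
    by (simp add: fixed_field_def cj_def algebra_simps)
  have S: "card ?S \<le> q"
    using card_roots_trinomial_le[OF q_gt_1, of "1" "0::'a"] 
    by (simp add: cj_def add_eq_0_iff2)
  have sub: "?R \<subseteq> ?S" by (auto simp: cj_simps)
  have RS: "card ?R \<le> card ?S" using sub by (intro card_mono) auto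
  show Fq: "card fixed_field = q"
  proof (rule ccontr)
    assume "card fixed_field \<noteq> q"
    hence "card fixed_field < q" using F by simp
    hence "q * card fixed_field < q * q" using q_gt_1 by simp
    moreover have "card ?R * card fixed_field \<le> q * card fixed_field" 
      using RS S by (intro mult_le_mono1) simp
    ultimately have "card ?R * card fixed_field < q * q" by (rule order_le_less_trans[rotated])
    thus False using prod by simp
  qed
  hence R: "card ?R = q" using prod q_gt_1 by simp
  thus S': "card ?S = q" using S RS by simp
  show "?R = ?S" by (rule card_subset_eq) (use sub R S' in auto)
qed

lemma trace_surj:
  assumes "cj b = b"
  obtains x where "x + cj x = b"
proof -
  let ?R = "range (\<lambda>x. x + cj x)"
  have "CARD('a) = card ?R * card {x. x + cj x = 0}"
    by (rule card_UNIV_eq_range_times_kernel) (simp add: cj_simps algebra_simps)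
  also have "{x. x + cj x = 0} = {x. cj x = - x}" by (auto simp: add_eq_0_iff)
  finally have "card ?R = card fixed_field" 
    using q_gt_1 by (simp add: card_skew card_field card_fixed_field power2_eq_square)
  moreover have "?R \<subseteq> fixed_field" by (auto simp: fixed_field_def cj_simps add.commute)
  ultimately have "?R = fixed_field" by (intro card_subset_eq) auto
  moreover have "b \<in> fixed_field" using assms by (simp add: fixed_field_def)
  ultimately show ?thesis using that by (metis rangeE)
qed

text \<open>Every fibre of the norm has at most \<open>q + 1\<close> elements, so its values on
  the \<open>q\<^sup>2 - 1\<close> nonzero elements of \<open>K\<close> are at least \<open>q -
  1\<close> in number.\<close>

lemma norm_surj:
  assumes "cj b = b"
  obtains x where "x * cj x = b"
proof (cases "b = 0")
  case True thus ?thesis using that[of 0] by simp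
next
  case False
  let ?U = "UNIV - {0 :: 'a}" and ?N = "\<lambda>x. x * cj x"
  have fibre: "card {x \<in> ?U. ?N x = c} \<le> q + 1" for c
  proof -
    have "card {x \<in> ?U. ?N x = c} \<le> card {x. x ^ (q + 1) + 0 * x + (- c) = 0}"
      by (rule card_mono) (auto simp: cj_def)
    also have "\<dots> \<le> q + 1" by (rule card_roots_trinomial_le) (use q_gt_1 in simp)
    finally show ?thesis .
  qed
  have "(q + 1) * (q - 1) = card ?U"
    by (simp add: card_Diff_subset card_field power2_eq_square algebra_simps)
  also have "?U = (\<Union>c\<in>?N ` ?U. {x \<in> ?U. ?N x = c})" by auto
  also have "card \<dots> \<le> (\<Sum>c\<in>?N ` ?U. card {x \<in> ?U. ?N x = c})"
    by (rule card_UN_le) auto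
  also have "\<dots> \<le> (\<Sum>c\<in>?N ` ?U. q + 1)" by (rule sum_mono) (rule fibre)
  finally have "(q + 1) * (q - 1) \<le> (q + 1) * card (?N ` ?U)" by (simp only: sum_constant of_nat_id mult.commute)
  hence "q - 1 \<le> card (?N ` ?U)" by (simp only: mult_le_cancel1)
  moreover have "?N ` ?U \<subseteq> fixed_field - {0}" by (auto simp: fixed_field_def cj_simps)
  moreover have "card (fixed_field - {0}) = q - 1"
    by (subst card_Diff_singleton) (auto simp: card_fixed_field, simp add: fixed_field_def)
  ultimately have "?N ` ?U = fixed_field - {0}"
    by (intro card_seteq) auto
  moreover have "b \<in> fixed_field - {0}" using assms False by (simp add: fixed_field_def)
  ultimately have "b \<in> ?N ` ?U" by simp
  thus ?thesis using that by blast
qed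

lemma ex_not_fixed: obtains \<theta> where "cj \<theta> \<noteq> \<theta>"
proof -
  have "card fixed_field < CARD('a)"
    using q_gt_1 by (simp add: card_fixed_field card_field power2_eq_square)
  hence "fixed_field \<noteq> UNIV" by auto
  thus ?thesis using that by (auto simp: fixed_field_def)
qed

text \<open>Up to a factor, the form that the Hermitian form induces on \<open>p\<^sup>\<bottom> /
  p\<close>. Working with a skew-Hermitian form makes its Gram matrix the standard symplectic one
  and the isotropic directions the points of the projective line over \<open>F\<close>.\<close>

definition skew_form :: "'a \<times> 'a \<Rightarrow> 'a \<times> 'a \<Rightarrow> 'a" where
  "skew_form a b = fst a * cj (snd b) - snd a * cj (fst b)"

lemma cj_skew_form: "cj (skew_form a b) = - skew_form b a"
  by (simp add: skew_form_def cj_simps)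

lemma skew_form_diff: "skew_form (a - b) c = skew_form a c - skew_form b c"
  "skew_form c (a - b) = skew_form c a - skew_form c b"
  by (auto simp: skew_form_def cj_simps algebra_simps)

abbreviation isotropic :: "'a \<times> 'a \<Rightarrow> bool" where
  "isotropic a \<equiv> skew_form a a = 0"

lemma isotropic_diff_commute: "isotropic (a - b) \<longleftrightarrow> isotropic (b - a)"
proof -
  have "skew_form (a - b) (a - b) = skew_form (b - a) (b - a)"
    by (simp add: skew_form_diff algebra_simps)
  thus ?thesis by simp
qed

text \<open>The values \<open>z\<close> for which the vector \<open>(1, a, z)\<close> of
  \<open>K\<^sup>4\<close> is isotropic, in the coordinates introduced later by
  \<open>symplectic_basis\<close>.\<close>

definition heights :: "'a \<times> 'a \<Rightarrow> 'a set" where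
  "heights a = {z. z - cj z = skew_form a a}"

lemma card_heights: "card (heights a) = q"
proof -
  have "skew_form a a \<in> range (\<lambda>x. x - cj x)"
    using cj_skew_form[of a a] by (simp add: range_minus_cj)
  then obtain z0 where z0: "z0 - cj z0 = skew_form a a" by auto
  have "card (heights a) = card fixed_field"
    by (rule bij_betw_same_card[of "\<lambda>x. x - z0"], 
        rule bij_betw_byWitness[where f' = "\<lambda>x. x + z0"]) 
       (auto simp: heights_def fixed_field_def cj_simps algebra_simps simp flip: z0)
  thus ?thesis by (simp add: card_fixed_field)
qed

text \<open>The projective line over \<open>F\<close>: \<open>Some s\<close> is the direction of
  slope \<open>s\<close>, and \<open>None\<close> is the vertical one.\<close>

definition directions :: "'a option set" where
  "directions = insert None (Some ` fixed_field)"

lemma card_directions: "card directions = q + 1"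
  by (simp add: directions_def card_image card_fixed_field)

lemma directions_cases:
  assumes "d \<in> directions"
  obtains "d = None" | s where "d = Some s" "cj s = s"
  using assms by (auto simp: directions_def fixed_field_def)

text \<open>Orthogonality of the vectors \<open>(1, a, z)\<close> and \<open>(1, b, w)\<close>;
  two orthogonal isotropic vectors of this shape over the same point of the plane are equal, which
  the inequality excludes.\<close>

definition height_adj :: "'a \<times> 'a \<Rightarrow> 'a \<Rightarrow> 'a \<times> 'a \<Rightarrow> 'a \<Rightarrow> bool" where
  "height_adj a z b w \<longleftrightarrow> a \<noteq> b \<and> z = cj w + skew_form a b"

lemma height_adj_sym: "height_adj a z b w \<longleftrightarrow> height_adj b w a z"
  unfolding height_adj_def by (auto simp: cj_simps cj_skew_form)

text \<open>Orthogonality to \<open>(1, a, z)\<close> determines the last coordinate over any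
  \<open>b\<close>, and the vector so obtained is isotropic precisely when \<open>a - b\<close>
  is. Hence \<open>(a, z)\<close> is adjacent to exactly one pair over each \<open>b \<noteq>
  a\<close> that is joined to \<open>a\<close>, and to none over the other points.\<close>

lemma height_adj_iff:
  assumes "z \<in> heights a"
  shows "w \<in> heights b \<and> height_adj a z b w \<longleftrightarrow> b \<noteq> a \<and> isotropic (a - b) \<and> w = cj z + skew_form b a"
proof -
  have z: "z - cj z = skew_form a a" using assms by (simp add: heights_def)
  have 1: "z = cj w + skew_form a b \<longleftrightarrow> w = cj z + skew_form b a"
    by (auto simp: cj_simps cj_skew_form)
  have "w - cj w = skew_form b b \<longleftrightarrow> isotropic (a - b)" if "w = cj z + skew_form b a"
  proof -
    have "w - cj w = - skew_form a a + skew_form b a + skew_form a b"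
      using z by (simp add: that cj_simps cj_skew_form) (simp add: algebra_simps flip: z)
    hence "w - cj w - skew_form b b = - skew_form (a - b) (a - b)"
      by (simp add: skew_form_diff algebra_simps)
    thus ?thesis by (metis eq_iff_diff_eq_0 neg_equal_0_iff_equal)
  qed
  thus ?thesis using 1 by (auto simp: height_adj_def heights_def)
qed

lemma card_height_adj:
  assumes "z \<in> heights a"
  shows "card {(b, w). w \<in> heights b \<and> height_adj a z b w \<and> P b w} = 
    card {b. b \<noteq> a \<and> isotropic (a - b) \<and> P b (cj z + skew_form b a)}"
proof (rule bij_betw_same_card[symmetric, of "\<lambda>b. (b, cj z + skew_form b a)"])
  have "{(b, w). w \<in> heights b \<and> height_adj a z b w \<and> P b w} = 
     {(b, w). b \<noteq> a \<and> isotropic (a - b) \<and> w = cj z + skew_form b a \<and> P b w}"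
    using height_adj_iff[OF assms] by blast
  thus "bij_betw (\<lambda>b. (b, cj z + skew_form b a)) {b. b \<noteq> a \<and> isotropic (a - b) \<and> P b (cj z + skew_form b a)}
     {(b, w). w \<in> heights b \<and> height_adj a z b w \<and> P b w}"
    by (auto simp: bij_betw_def inj_on_def)
qed

end

section \<open>Nets on the affine plane\<close>

context hermitian_field
begin

definition scale :: "'a \<Rightarrow> 'a \<times> 'a \<Rightarrow> 'a \<times> 'a" where
  "scale \<mu> a = (\<mu> * fst a, \<mu> * snd a)"

definition dir_vec :: "'a option \<Rightarrow> 'a \<times> 'a" where
  "dir_vec d = (case d of None \<Rightarrow> (0, 1) | Some s \<Rightarrow> (1, s))"

text \<open>The affine lines in direction \<open>d\<close> are the sets on which \<open>intercept
  d\<close> is constant. The sign in the vertical case makes \<open>skew_form (dir_vec d) a = cj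
  (intercept d a)\<close> hold for every direction.\<close>

definition intercept :: "'a option \<Rightarrow> 'a \<times> 'a \<Rightarrow> 'a" where
  "intercept d a = (case d of None \<Rightarrow> - fst a | Some s \<Rightarrow> snd a - s * fst a)"

lemma intercept_diff: "intercept d (a - b) = intercept d a - intercept d b"
  by (cases d) (auto simp: intercept_def zero_prod_def algebra_simps)

lemma intercept_scale: "intercept d (scale \<mu> a) = \<mu> * intercept d a"
  by (cases d) (auto simp: intercept_def scale_def algebra_simps)

lemma intercept_dir_vec: "intercept d (dir_vec d) = 0"
  by (cases d) (auto simp: intercept_def dir_vec_def)

lemma intercept_eq_0_iff: "intercept d a = 0 \<longleftrightarrow> (\<exists>\<mu>. a = scale \<mu> (dir_vec d))"
proof
  assume "intercept d a = 0"
  thus "\<exists>\<mu>. a = scale \<mu> (dir_vec d)"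
    by (cases d; cases a) (auto simp: intercept_def scale_def dir_vec_def mult.commute)
qed (auto simp: intercept_scale intercept_dir_vec)

lemma scale_dir_vec_inject: "scale \<mu> (dir_vec d) = scale \<nu> (dir_vec d) \<longleftrightarrow> \<mu> = \<nu>"
  by (cases d) (auto simp: scale_def dir_vec_def)

lemma skew_form_dir_vec: "d \<in> directions \<Longrightarrow> skew_form (dir_vec d) a = cj (intercept d a)"
  by (erule directions_cases) (auto simp: skew_form_def dir_vec_def intercept_def cj_simps)

lemma skew_form_scale: "skew_form a (scale \<mu> b) = cj \<mu> * skew_form a b"
  by (simp add: skew_form_def scale_def cj_simps algebra_simps)

lemma isotropic_iff_intercept: "isotropic a \<longleftrightarrow> (\<exists>d\<in>directions. intercept d a = 0)"
proof
  obtain x y where a: "a = (x, y)" by (cases a)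
  assume "isotropic a"
  hence *: "x * cj y = y * cj x" by (simp add: a skew_form_def)
  show "\<exists>d\<in>directions. intercept d a = 0"
  proof (cases "x = 0")
    case True
    thus ?thesis by (auto simp: directions_def intercept_def a)
  next
    case False
    have "cj (y / x) = y / x" using * False by (simp add: cj_simps field_simps)
    thus ?thesis using False
      by (intro bexI[of _ "Some (y / x)"]) (auto simp: directions_def fixed_field_def intercept_def a)
  qed
next
  assume "\<exists>d\<in>directions. intercept d a = 0"
  then obtain d \<mu> where d: "d \<in> directions" "a = scale \<mu> (dir_vec d)" by (auto simp: intercept_eq_0_iff)
  have "skew_form (dir_vec d) a = 0" 
    using d by (simp add: skew_form_dir_vec intercept_scale intercept_dir_vec)
  thus "isotropic a" by (simp add: d(2)) (simp add: skew_form_def scale_def)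
qed

lemma intercept_eq_0_unique: "intercept d a = 0 \<Longrightarrow> intercept d' a = 0 \<Longrightarrow> d \<noteq> d' \<Longrightarrow> a = 0"
  by (cases d; cases d'; cases a) (auto simp: intercept_def zero_prod_def algebra_simps)

end

text \<open>A net on \<open>K\<^sup>2\<close> with parallel classes indexed by the directions,
  each class given by its map onto the set of its lines. Which points are joined is prescribed.
  The affine lines in the isotropic directions are one example, and their transposes are
  another.\<close>

locale net = hermitian_field q K for q and K :: "'a::{field,finite} itself" +
  fixes line :: "'a option \<Rightarrow> 'a \<times> 'a \<Rightarrow> 'a"
  assumes meet: "d \<in> directions \<Longrightarrow> d' \<in> directions \<Longrightarrow> d \<noteq> d' \<Longrightarrow> \<exists>!a. line d a = c \<and> line d' a = c'"
    and joined: "a \<noteq> b \<Longrightarrow> isotropic (a - b) \<longleftrightarrow> (\<exists>d\<in>directions. line d a = line d b)"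
begin

lemma line_unique: 
  assumes "d \<in> directions" "d' \<in> directions" "line d a = line d b" "line d' a = line d' b" "a \<noteq> b" 
  shows "d = d'"
  using meet[of d d' "line d b" "line d' b"] assms by blast

lemma ex_other_direction:
  assumes "d \<in> directions" obtains d' where "d' \<in> directions" "d' \<noteq> d"
proof -
  have "card {d} < card directions" using q_gt_1 by (simp add: card_directions)
  hence "\<not> directions \<subseteq> {d}" by (metis card_mono finite not_less)
  thus ?thesis using that by blast
qed

lemma card_line:
  assumes d: "d \<in> directions"
  shows "card {a. line d a = c} = q\<^sup>2"
proof -
  obtain d' where d': "d' \<in> directions" "d' \<noteq> d" using ex_other_direction[OF d] .
  have "bij_betw (line d') {a. line d a = c} UNIV"
    unfolding bij_betw_def
  proof
    show "inj_on (line d') {a. line d a = c}"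
    proof (rule inj_onI)
      fix a b assume "a \<in> {a. line d a = c}" "b \<in> {a. line d a = c}" "line d' a = line d' b"
      thus "a = b" using line_unique[OF d d'(1), of a b] d'(2) by auto
    qed
    have "c' \<in> line d' ` {a. line d a = c}" for c'
    proof -
      obtain a where "line d a = c" "line d' a = c'"
        using ex1_implies_ex[OF meet[OF d d'(1) d'(2)[symmetric], of c c']] by auto
      thus ?thesis by auto
    qed
    thus "line d' ` {a. line d a = c} = UNIV" by blast
  qed
  thus ?thesis by (metis bij_betw_same_card card_field)
qed

lemma card_lines_joining: 
  "card {d \<in> directions. line d a = line d b} = 
     (if a = b then q + 1 else if isotropic (a - b) then 1 else 0)"
proof (cases "a = b")
  case True
  thus ?thesis by (simp add: card_directions)
next
  case ab: False
  show ?thesis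
  proof (cases "isotropic (a - b)")
    case True
    then obtain d where d: "d \<in> directions" "line d a = line d b" using joined ab by blast
    hence "{d \<in> directions. line d a = line d b} = {d}" using line_unique ab by blast
    thus ?thesis using ab True by simp
  next
    case False
    hence "{d \<in> directions. line d a = line d b} = {}" using joined ab by blast
    thus ?thesis using ab False by (simp only: card.empty if_False)
  qed
qed

lemma joined_sym:
  assumes "b \<noteq> a" 
  shows "isotropic (a - b) \<longleftrightarrow> (\<exists>d\<in>directions. line d b = line d a)"
  unfolding joined[OF assms[symmetric]] by (metis (no_types))

lemma card_isotropic: "card {b. b \<noteq> a \<and> isotropic (a - b)} = (q + 1) * (q\<^sup>2 - 1)"
proof -
  have "{b. b \<noteq> a \<and> isotropic (a - b)} = (\<Union>d\<in>directions. {b. line d b = line d a} - {a})"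
    by (auto simp: joined_sym)
  also have "card \<dots> = (\<Sum>d\<in>directions. card ({b. line d b = line d a} - {a}))"
  proof (rule card_UN_disjoint)
    have "d = d'" if "d \<in> directions" "d' \<in> directions" "line d b = line d a" "line d' b = line d' a" "b \<noteq> a" for d d' b
      using line_unique[of d d' b a] that by blast
    thus "\<forall>d\<in>directions. \<forall>d'\<in>directions. d \<noteq> d' \<longrightarrow> 
       ({b. line d b = line d a} - {a}) \<inter> ({b. line d' b = line d' a} - {a}) = {}" by blast
  qed auto
  also have "\<dots> = (\<Sum>d\<in>directions. q\<^sup>2 - 1)"
    by (intro sum.cong refl, subst card_Diff_singleton) (auto simp: card_line)
  finally show ?thesis by (simp add: card_directions)
qed

text \<open>If \<open>a\<close> is not on the line, then each of the other \<open>q\<close>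
  parallel classes has one line through \<open>a\<close>, and it meets the given line in one
  point.\<close>

lemma card_isotropic_on_line:
  assumes d: "d \<in> directions"
  shows "card {b. b \<noteq> a \<and> isotropic (a - b) \<and> line d b = c} = (if line d a = c then q\<^sup>2 - 1 else q)"
proof (cases "line d a = c")
  case True
  have "{b. b \<noteq> a \<and> isotropic (a - b) \<and> line d b = c} = {b. line d b = c} - {a}"
    using True d by (auto simp: joined_sym)
  thus ?thesis using True card_line[OF d, of c] by (simp add: card_Diff_singleton)
next
  case False
  define f where "f d' = (THE b. line d b = c \<and> line d' b = line d' a)" for d'
  have f: "line d b = c \<and> line d' b = line d' a \<longleftrightarrow> b = f d'" if "d' \<in> directions - {d}" for d' b
  proof -
    have "\<exists>!b. line d b = c \<and> line d' b = line d' a" by (rule meet) (use d that in auto)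
    from theI'[OF this] this show ?thesis unfolding f_def by blast
  qed
  have "bij_betw f (directions - {d}) {b. b \<noteq> a \<and> isotropic (a - b) \<and> line d b = c}"
    unfolding bij_betw_def
  proof
    have fa: "f d' \<noteq> a" if "d' \<in> directions - {d}" for d' using f[OF that, of "f d'"] False by auto
    show "inj_on f (directions - {d})"
    proof (rule inj_onI)
      fix d1 d2 assume *: "d1 \<in> directions - {d}" "d2 \<in> directions - {d}" "f d1 = f d2"
      show "d1 = d2"
        using line_unique[of d1 d2 "f d1" a] f[of d1 "f d1"] f[of d2 "f d2"] fa[of d1] * by auto
    qed
    show "f ` (directions - {d}) = {b. b \<noteq> a \<and> isotropic (a - b) \<and> line d b = c}"
    proof (intro equalityI subsetI)
      fix b assume "b \<in> f ` (directions - {d})"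
      then obtain d' where d': "d' \<in> directions - {d}" "b = f d'" by blast
      thus "b \<in> {b. b \<noteq> a \<and> isotropic (a - b) \<and> line d b = c}"
        using f[OF d'(1), of b] fa[OF d'(1)] joined_sym[of b a] by auto
    next
      fix b assume b: "b \<in> {b. b \<noteq> a \<and> isotropic (a - b) \<and> line d b = c}"
      then obtain d' where d': "d' \<in> directions" "line d' a = line d' b" using joined[of a b] by auto
      hence "d' \<in> directions - {d}" using b False by auto
      thus "b \<in> f ` (directions - {d})" using f[of d' b] d' b by auto
    qed
  qed
  from bij_betw_same_card[OF this]
  have "card {b. b \<noteq> a \<and> isotropic (a - b) \<and> line d b = c} = card (directions - {d})"
    by (rule sym)
  thus ?thesis using False d by (simp add: card_directions card_Diff_singleton)
qed

end

sublocale hermitian_field \<subseteq> std: net q K intercept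
proof
  show "\<exists>!a. intercept d a = c \<and> intercept d' a = c'" if "d \<in> directions" "d' \<in> directions" "d \<noteq> d'" for d d' c c'
  proof (rule ex_ex1I)
    show "a = b" if "intercept d a = c \<and> intercept d' a = c'" "intercept d b = c \<and> intercept d' b = c'" for a b
      using intercept_eq_0_unique[of d "a - b" d'] that \<open>d \<noteq> d'\<close> by (simp add: intercept_diff)
    show "\<exists>a. intercept d a = c \<and> intercept d' a = c'"
    proof (cases d)
      case None
      with that obtain s where "d' = Some s" by (cases d') auto
      thus ?thesis using None by (intro exI[of _ "(- c, c' - s * c)"]) (simp add: intercept_def)
    next
      case (Some s)
      show ?thesis
      proof (cases d')
        case None
        thus ?thesis using Some by (intro exI[of _ "(- c', c - s * c')"]) (simp add: intercept_def)
      next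
        case (Some s')
        hence s: "s - s' \<noteq> 0" using \<open>d = Some s\<close> that by auto
        let ?x = "(c' - c) / (s - s')"
        have "(s - s') * ?x = c' - c" using s by simp
        hence "c + s * ?x - s' * ?x = c'" by (simp only: left_diff_distrib) (simp add: algebra_simps)
        thus ?thesis using Some \<open>d = Some s\<close>
          by (intro exI[of _ "(?x, c + s * ?x)"]) (simp add: intercept_def)
      qed
    qed
  qed
  show "isotropic (a - b) \<longleftrightarrow> (\<exists>d\<in>directions. intercept d a = intercept d b)" for a b
    by (simp add: isotropic_iff_intercept intercept_diff)
qed

context hermitian_field
begin

text \<open>This is the quadrangle axiom in coordinates. The neighbours of \<open>(a, z)\<close>
  over the plane lie on \<open>q + 1\<close> lines, one for each direction \<open>d\<close>,
  parametrized by \<open>a + \<mu> d\<close>. On such a line, adjacency to \<open>(b, w)\<close>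
  is an affine-linear equation for \<open>cj \<mu>\<close> with constant term \<open>E\<close> and
  with leading coefficient zero iff \<open>a\<close> and \<open>b\<close> lie on a common line in
  direction \<open>d\<close>. If \<open>E \<noteq> 0\<close>, there is one solution for every
  direction with nonzero coefficient. If \<open>E = 0\<close>, which means that \<open>(a,
  z)\<close> and \<open>(b, w)\<close> are adjacent, then the solutions with \<open>\<mu> \<noteq>
  0\<close>, together with \<open>a\<close>, fill the affine line through \<open>a\<close> and
  \<open>b\<close>, from which \<open>b\<close> itself has to be removed.\<close>

lemma card_common_height_adj:
  assumes z: "z \<in> heights a" and w: "w \<in> heights b" and ne: "(a, z) \<noteq> (b, w)"
  shows "card {(c, u). u \<in> heights c \<and> height_adj a z c u \<and> height_adj b w c u} =
    (if height_adj a z b w then q\<^sup>2 - 2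
     else if a = b then 0 else if isotropic (a - b) then q else q + 1)"
proof -
  define E where "E = w - cj z - skew_form b a"
  have E0: "E = 0 \<longleftrightarrow> height_adj a z b w"
  proof -
    have "E \<noteq> 0" if "a = b"
    proof -
      have "skew_form b a = z - cj z" using that z by (simp add: heights_def)
      hence "E = w - z" by (simp add: E_def)
      thus ?thesis using that ne by auto
    qed
    moreover have "E = 0 \<longleftrightarrow> w = cj z + skew_form b a" by (auto simp: E_def algebra_simps)
    ultimately show ?thesis unfolding height_adj_sym[of a] by (auto simp: height_adj_def)
  qed
  have eq: "w = cj (cj z + skew_form c a) + skew_form b c \<longleftrightarrow> skew_form (b - a) (c - a) = E" for c
  proof -
    have "skew_form a a = z - cj z" using z by (simp add: heights_def)
    hence "w - (cj (cj z + skew_form c a) + skew_form b c) = E - skew_form (b - a) (c - a)"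
      by (simp add: E_def cj_simps cj_skew_form skew_form_diff algebra_simps)
    thus ?thesis by (metis eq_iff_diff_eq_0)
  qed
  have "card {(c, u). u \<in> heights c \<and> height_adj a z c u \<and> height_adj b w c u} = 
    card {c. c \<noteq> a \<and> isotropic (a - c) \<and> height_adj b w c (cj z + skew_form c a)}"
    by (rule card_height_adj[OF z])
  also have "{c. c \<noteq> a \<and> isotropic (a - c) \<and> height_adj b w c (cj z + skew_form c a)} =
     {c. c \<noteq> a \<and> c \<noteq> b \<and> isotropic (c - a) \<and> skew_form (b - a) (c - a) = E}" (is "_ = ?C")
    using eq by (auto simp: height_adj_def isotropic_diff_commute)
  also have "card ?C = (if E = 0 then q\<^sup>2 - 2 else card {d \<in> directions. intercept d (b - a) \<noteq> 0})"
  proof -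
    have form: "skew_form (b - a) (scale \<mu> (dir_vec d)) = - (cj \<mu> * intercept d (b - a))" 
      if "d \<in> directions" for \<mu> d
    proof -
      have "skew_form (b - a) (dir_vec d) = - cj (skew_form (dir_vec d) (b - a))"
        by (simp add: cj_skew_form)
      thus ?thesis using that by (simp add: skew_form_scale skew_form_dir_vec)
    qed
    \<comment> \<open>Parametrization of the common neighbours by direction and parameter.\<close>
    have C: "c \<in> ?C \<longleftrightarrow> c \<noteq> b \<and> 
        (\<exists>d\<in>directions. \<exists>\<mu>. \<mu> \<noteq> 0 \<and> c = a + scale \<mu> (dir_vec d) \<and> - (cj \<mu> * intercept d (b - a)) = E)" for c
    proof -
      have "c \<noteq> a \<and> isotropic (c - a) \<and> skew_form (b - a) (c - a) = E \<longleftrightarrow>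
        (\<exists>d\<in>directions. \<exists>\<mu>. c \<noteq> a \<and> c - a = scale \<mu> (dir_vec d) \<and> skew_form (b - a) (c - a) = E)"
        by (auto simp: isotropic_iff_intercept intercept_eq_0_iff)
      also have "\<dots> \<longleftrightarrow> (\<exists>d\<in>directions. \<exists>\<mu>. \<mu> \<noteq> 0 \<and> c - a = scale \<mu> (dir_vec d) \<and> - (cj \<mu> * intercept d (b - a)) = E)"
      proof (intro bex_cong ex_cong1 refl)
        fix d \<mu> assume d: "d \<in> directions"
        have "scale \<mu> (dir_vec d) = 0 \<longleftrightarrow> \<mu> = 0"
          using scale_dir_vec_inject[of \<mu> d 0] by (auto simp: scale_def zero_prod_def)
        thus "(c \<noteq> a \<and> c - a = scale \<mu> (dir_vec d) \<and> skew_form (b - a) (c - a) = E) \<longleftrightarrow>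
           (\<mu> \<noteq> 0 \<and> c - a = scale \<mu> (dir_vec d) \<and> - (cj \<mu> * intercept d (b - a)) = E)"
          using form[OF d, of \<mu>] by (metis eq_iff_diff_eq_0)
      qed
      also have "\<dots> \<longleftrightarrow> (\<exists>d\<in>directions. \<exists>\<mu>. \<mu> \<noteq> 0 \<and> c = a + scale \<mu> (dir_vec d) \<and> - (cj \<mu> * intercept d (b - a)) = E)"
        by (simp only: diff_eq_eq add.commute)
      finally show ?thesis by auto
    qed
    show ?thesis
    proof (cases "E = 0")
      case True
      hence adj: "a \<noteq> b" "isotropic (a - b)"
        using E0 z w height_adj_iff[OF z, of w b] by auto
      then obtain d0 where d0: "d0 \<in> directions" "intercept d0 a = intercept d0 b"
        using std.joined by blast
      have "?C = {c. intercept d0 c = intercept d0 a} - {a, b}"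
      proof (intro equalityI subsetI)
        fix c assume "c \<in> ?C"
        then obtain d \<mu> where c: "c \<noteq> b" "d \<in> directions" "\<mu> \<noteq> 0" "c = a + scale \<mu> (dir_vec d)" 
           "cj \<mu> * intercept d (b - a) = 0" and "c \<noteq> a" unfolding C using True \<open>c \<in> ?C\<close> by auto
        have "intercept d b = intercept d a" using c by (simp add: intercept_diff)
        hence "d = d0" using std.line_unique[of d d0 a b] c d0 adj by auto
        moreover have "intercept d (c - a) = 0" unfolding c(4) by (simp add: intercept_scale intercept_dir_vec)
        hence "intercept d c = intercept d a" by (simp only: intercept_diff) simp
        ultimately show "c \<in> {c. intercept d0 c = intercept d0 a} - {a, b}"
          using \<open>c \<noteq> b\<close> \<open>c \<noteq> a\<close> by simp
      next
        fix c assume c: "c \<in> {c. intercept d0 c = intercept d0 a} - {a, b}"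
        hence "intercept d0 (c - a) = 0" by (simp add: intercept_diff)
        then obtain \<mu> where \<mu>: "c - a = scale \<mu> (dir_vec d0)" by (auto simp: intercept_eq_0_iff)
        have "isotropic (c - a)" 
          using \<open>intercept d0 (c - a) = 0\<close> d0 unfolding isotropic_iff_intercept by blast
        moreover have "skew_form (b - a) (c - a) = E"
          unfolding \<mu> form[OF d0(1)] using True d0 by (simp add: intercept_diff)
        ultimately show "c \<in> ?C" using c by auto
      qed
      moreover have "card ({c. intercept d0 c = intercept d0 a} - {a, b}) = q\<^sup>2 - 2"
        using std.card_line[OF d0(1), of "intercept d0 a"] d0 adj by (subst card_Diff_subset) auto
      ultimately show ?thesis using True by simp
    next
      case False
      define f where "f d = a + scale (cj (- E / intercept d (b - a))) (dir_vec d)" for d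
      have "bij_betw f {d \<in> directions. intercept d (b - a) \<noteq> 0} ?C"
        unfolding bij_betw_def
      proof
        show "inj_on f {d \<in> directions. intercept d (b - a) \<noteq> 0}"
        proof (rule inj_onI)
          fix d d' assume *: "d \<in> {d \<in> directions. intercept d (b - a) \<noteq> 0}" 
            "d' \<in> {d \<in> directions. intercept d (b - a) \<noteq> 0}" "f d = f d'"
          have "intercept d (f d - a) = 0" "intercept d' (f d' - a) = 0" by (simp_all add: f_def intercept_scale intercept_dir_vec)
          moreover have "f d - a \<noteq> 0"
            using * False by (cases d) (auto simp: f_def scale_def dir_vec_def zero_prod_def)
          ultimately show "d = d'" using intercept_eq_0_unique[of d "f d - a" d'] * by auto
        qed
        have \<mu>: "\<mu> \<noteq> 0 \<and> - (cj \<mu> * intercept d (b - a)) = E \<longleftrightarrow> intercept d (b - a) \<noteq> 0 \<and> \<mu> = cj (- E / intercept d (b - a))" for d \<mu>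
        proof -
          have "- (cj \<mu> * intercept d (b - a)) = E \<longleftrightarrow> intercept d (b - a) \<noteq> 0 \<and> cj \<mu> = - E / intercept d (b - a)"
            using False by (auto simp: field_simps)
          moreover have "cj \<mu> = x \<longleftrightarrow> \<mu> = cj x" for x by auto
          ultimately show ?thesis using False by (auto simp: field_simps)
        qed
        have nb: "f d \<noteq> b" if "d \<in> directions" "intercept d (b - a) \<noteq> 0" for d
        proof
          assume "f d = b"
          hence "intercept d (b - a) = intercept d (f d - a)" by simp
          also have "\<dots> = 0" by (simp add: f_def intercept_scale intercept_dir_vec)
          finally show False using that by simp
        qed
        have C_iff: "c \<in> ?C \<longleftrightarrow> c \<noteq> b \<and> (\<exists>d\<in>directions. intercept d (b - a) \<noteq> 0 \<and> c = f d)" for c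
          unfolding C f_def using \<mu> by metis
        show "f ` {d \<in> directions. intercept d (b - a) \<noteq> 0} = ?C"
        proof (rule Set.set_eqI)
          fix c
          have "c \<in> f ` {d \<in> directions. intercept d (b - a) \<noteq> 0} \<longleftrightarrow> 
              (\<exists>d\<in>directions. intercept d (b - a) \<noteq> 0 \<and> c = f d)" by blast
          also have "\<dots> \<longleftrightarrow> c \<in> ?C" unfolding C_iff using nb by blast
          finally show "c \<in> f ` {d \<in> directions. intercept d (b - a) \<noteq> 0} \<longleftrightarrow> c \<in> ?C" .
        qed
      qed
      thus ?thesis using False by (simp add: bij_betw_same_card)
    qed
  qed
  also have "card {d \<in> directions. intercept d (b - a) \<noteq> 0} = 
      (if a = b then 0 else if isotropic (a - b) then q else q + 1)"
  proof -
    have "{d \<in> directions. intercept d (b - a) \<noteq> 0} = directions - {d \<in> directions. intercept d a = intercept d b}"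
      by (auto simp: intercept_diff)
    hence "card {d \<in> directions. intercept d (b - a) \<noteq> 0} = 
        card directions - card {d \<in> directions. intercept d a = intercept d b}"
      by (simp add: card_Diff_subset)
    thus ?thesis by (simp only: card_directions std.card_lines_joining) simp
  qed
  finally show ?thesis by (simp only: E0)
qed

end

section \<open>The strongly regular graph of a net\<close>

text \<open>\<open>Apex\<close> is the base point, the vertices \<open>Near d c\<close> are its
  neighbours, one for each line of the net, and \<open>Far a z\<close> is a vertex at height
  \<open>z\<close> over the point \<open>a\<close> of the plane.\<close>

datatype 'a vertex = Apex | Near "'a option" 'a | Far "'a \<times> 'a" 'a

definition (in hermitian_field) vertices :: "'a vertex set" where
  "vertices = {v. case v of Apex \<Rightarrow> True | Near d c \<Rightarrow> d \<in> directions | Far a z \<Rightarrow> z \<in> heights a}"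

lemma (in hermitian_field) mem_vertices [simp]:
  "Apex \<in> vertices" "Near d c \<in> vertices \<longleftrightarrow> d \<in> directions" "Far a z \<in> vertices \<longleftrightarrow> z \<in> heights a"
  by (auto simp: vertices_def)

lemma vertex_in_image [simp]:
  "Near d c \<in> (\<lambda>(d, c). Near d c) ` S \<longleftrightarrow> (d, c) \<in> S"
  "Far a z \<in> (\<lambda>(a, z). Far a z) ` T \<longleftrightarrow> (a, z) \<in> T"
  "Apex \<notin> (\<lambda>(d, c). Near d c) ` S" "Apex \<notin> (\<lambda>(a, z). Far a z) ` T"
  "Near d c \<notin> (\<lambda>(a, z). Far a z) ` T" "Far a z \<notin> (\<lambda>(d, c). Near d c) ` S"
  by (auto simp: image_iff split: prod.splits)

lemma (in hermitian_field) vertices_split: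
  "{v \<in> vertices. P v} = ((if P Apex then {Apex} else {}) 
     \<union> (\<lambda>(d, c). Near d c) ` {(d, c). d \<in> directions \<and> P (Near d c)}) 
     \<union> (\<lambda>(a, z). Far a z) ` {(a, z). z \<in> heights a \<and> P (Far a z)}"
proof (rule Set.set_eqI)
  fix v
  show "v \<in> {v \<in> vertices. P v} \<longleftrightarrow> v \<in> ((if P Apex then {Apex} else {}) 
     \<union> (\<lambda>(d, c). Near d c) ` {(d, c). d \<in> directions \<and> P (Near d c)}) 
     \<union> (\<lambda>(a, z). Far a z) ` {(a, z). z \<in> heights a \<and> P (Far a z)}"
    by (cases v) (simp_all only: Un_iff mem_Collect_eq mem_vertices vertex_in_image, auto)
qed

lemma (in hermitian_field) card_vertices_split:
  "card {v \<in> vertices. P v} = (if P Apex then 1 else 0) 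
     + card {(d, c). d \<in> directions \<and> P (Near d c)} + card {(a, z). z \<in> heights a \<and> P (Far a z)}"
proof -
  let ?A = "if P Apex then {Apex} else {}"
  let ?N = "(\<lambda>(d, c). Near d c) ` {(d, c). d \<in> directions \<and> P (Near d c)}"
  let ?F = "(\<lambda>(a, z). Far a z) ` {(a, z). z \<in> heights a \<and> P (Far a z)}"
  have "card ((?A \<union> ?N) \<union> ?F) = card (?A \<union> ?N) + card ?F"
    by (rule card_Un_disjoint) (auto split: if_splits)
  moreover have "card (?A \<union> ?N) = card ?A + card ?N"
    using card_Un_disjoint[of ?A ?N] by (simp add: disjoint_iff)
  moreover have "card ?N = card {(d, c). d \<in> directions \<and> P (Near d c)}"
    by (rule card_image) (auto simp: inj_on_def)
  moreover have "card ?F = card {(a, z). z \<in> heights a \<and> P (Far a z)}"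
    by (rule card_image) (auto simp: inj_on_def)
  ultimately show ?thesis unfolding vertices_split by simp
qed

lemma (in hermitian_field) finite_vertices: "finite vertices"
  using vertices_split[of "\<lambda>_. True"] by simp

lemma (in hermitian_field) q_sq_ge_2: "2 \<le> q\<^sup>2"
  using mult_le_mono[of 2 q 1 q] q_gt_1 by (simp add: power2_eq_square)

context net
begin

fun vadj :: "'a vertex \<Rightarrow> 'a vertex \<Rightarrow> bool" where
  "vadj Apex Apex = False"
| "vadj Apex (Near d c) = True"
| "vadj Apex (Far a z) = False"
| "vadj (Near d c) Apex = True"
| "vadj (Near d c) (Near d' c') = (d = d' \<and> c \<noteq> c')"
| "vadj (Near d c) (Far a z) = (line d a = c)"
| "vadj (Far a z) Apex = False"
| "vadj (Far a z) (Near d c) = (line d a = c)"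
| "vadj (Far a z) (Far b w) = height_adj a z b w"

definition net_graph :: "'a vertex pair_pre_digraph" where
  "net_graph = \<lparr>pverts = vertices, parcs = {(x, y). x \<in> vertices \<and> y \<in> vertices \<and> vadj x y}\<rparr>"

lemma vadj_sym: "vadj x y \<longleftrightarrow> vadj y x"
  by (cases x; cases y) (auto simp: height_adj_sym)

lemma not_vadj_self: "\<not> vadj x x"
  by (cases x) (auto simp: height_adj_def)

lemma card_classes_through: 
  "card {(d, c). d \<in> directions \<and> line d a = c \<and> P d c} = card {d \<in> directions. P d (line d a)}"
  by (rule bij_betw_same_card[symmetric, of "\<lambda>d. (d, line d a)"]) (auto simp: bij_betw_def inj_on_def)

lemma card_lifts: "card {(a, z). z \<in> heights a \<and> P a} = q * card {a. P a}"
proof -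
  have "{(a, z). z \<in> heights a \<and> P a} = (SIGMA a:{a. P a}. heights a)" by auto
  thus ?thesis by (simp add: card_heights mult.commute)
qed

lemma degree:
  assumes "x \<in> vertices"
  shows "card {v \<in> vertices. vadj x v} = q\<^sup>2 * (q + 1)"
proof (cases x)
  case Apex
  have "{(d, c). d \<in> directions} = directions \<times> (UNIV :: 'a set)" by auto
  thus ?thesis
    by (simp add: card_vertices_split Apex card_directions card_cartesian_product card_field mult.commute)
next
  case (Near d c)
  hence d: "d \<in> directions" using assms by simp
  have "{(d', c'). d' \<in> directions \<and> d = d' \<and> c \<noteq> c'} = {d} \<times> (UNIV - {c})" using d by auto
  hence "card {(d', c'). d' \<in> directions \<and> d = d' \<and> c \<noteq> c'} = q\<^sup>2 - 1" 
    by (simp add: card_cartesian_product card_field card_Diff_singleton)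
  thus ?thesis using q_gt_1
    by (simp add: card_vertices_split Near card_lifts card_line[OF d] algebra_simps)
next
  case (Far a z)
  hence z: "z \<in> heights a" using assms by simp
  have "card {(b, w). w \<in> heights b \<and> height_adj a z b w} = (q + 1) * (q\<^sup>2 - 1)"
    using card_height_adj[OF z, of "\<lambda>_ _. True"] by (simp add: card_isotropic)
  moreover have "card {(d, c). d \<in> directions \<and> line d a = c} = q + 1"
    using card_classes_through[of a "\<lambda>_ _. True"] by (simp add: card_directions)
  moreover have "(q + 1) + (q + 1) * (q\<^sup>2 - 1) = q\<^sup>2 * (q + 1)"
  proof -
    have "m + m * n = (1 + n) * m" for m n :: nat by (simp add: algebra_simps)
    from this[of "q + 1" "q\<^sup>2 - 1"] show ?thesis using q_gt_1 by simp
  qed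
  ultimately show ?thesis
    by (simp add: card_vertices_split Far)
qed

abbreviation common :: "'a vertex \<Rightarrow> 'a vertex \<Rightarrow> nat" where
  "common x y \<equiv> card {v \<in> vertices. vadj x v \<and> vadj y v}"

text \<open>The number of common neighbours in a \<open>GQ(q\<^sup>2, q)\<close>.\<close>

abbreviation expected :: "'a vertex \<Rightarrow> 'a vertex \<Rightarrow> nat" where
  "expected x y \<equiv> (if vadj x y then q\<^sup>2 - 1 else q + 1)"

lemma common_Apex_Near:
  assumes d: "d \<in> directions"
  shows "common Apex (Near d c) = expected Apex (Near d c)"
proof -
  have "{(d', c'). d' \<in> directions \<and> d = d' \<and> c \<noteq> c'} = {d} \<times> (UNIV - {c})" using d by auto
  thus ?thesis
    by (simp add: card_vertices_split card_cartesian_product card_field card_Diff_singleton)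
qed

lemma common_Apex_Far: "common Apex (Far a z) = expected Apex (Far a z)"
  using card_classes_through[of a "\<lambda>_ _. True"] by (simp add: card_vertices_split card_directions)

lemma common_Near_Near:
  assumes d: "d \<in> directions" and d': "d' \<in> directions" and ne: "(d, c) \<noteq> (d', c')"
  shows "common (Near d c) (Near d' c') = expected (Near d c) (Near d' c')"
proof (cases "d = d'")
  case True
  hence c: "c \<noteq> c'" using ne by simp
  have "{(e, b). e \<in> directions \<and> vadj (Near d c) (Near e b) \<and> vadj (Near d' c') (Near e b)} = 
      {d} \<times> (UNIV - {c, c'})" 
    using d True by auto
  moreover have "card (UNIV - {c, c'}) = q\<^sup>2 - 2"
    using c by (subst card_Diff_subset) (auto simp: card_field)
  ultimately have near: "card {(e, b). e \<in> directions \<and> vadj (Near d c) (Near e b) \<and> vadj (Near d' c') (Near e b)} = 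
      q\<^sup>2 - 2"
    by (simp only: card_cartesian_product card_1_singleton_iff) simp
  have "{(a, z). z \<in> heights a \<and> vadj (Near d c) (Far a z) \<and> vadj (Near d' c') (Far a z)} = {}" 
    using True c by auto
  thus ?thesis using True c q_sq_ge_2
    unfolding card_vertices_split near by (simp only: card.empty) simp
next
  case False
  obtain a0 where a0: "line d a = c \<and> line d' a = c' \<longleftrightarrow> a = a0" for a
    using meet[OF d d' False, of c c'] by metis
  have "{(e, b). e \<in> directions \<and> d = e \<and> c \<noteq> b \<and> d' = e \<and> c' \<noteq> b} = {}" using False by auto
  moreover have "card {(a, z). z \<in> heights a \<and> line d a = c \<and> line d' a = c'} = q"
    using card_lifts[of "\<lambda>a. line d a = c \<and> line d' a = c'"] by (simp add: a0)
  ultimately show ?thesis using False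
    by (simp add: card_vertices_split)
qed

lemma common_Near_Far:
  assumes d: "d \<in> directions" and z: "z \<in> heights a"
  shows "common (Near d c) (Far a z) = expected (Near d c) (Far a z)"
proof -
  have "{(e, b). e \<in> directions \<and> (d = e \<and> c \<noteq> b) \<and> line e a = b} = 
      (if line d a = c then {} else {(d, line d a)})"
    using d by auto
  hence near: "card {(e, b). e \<in> directions \<and> (d = e \<and> c \<noteq> b) \<and> line e a = b} = (if line d a = c then 0 else 1)"
    by simp
  have "card {(b, w). w \<in> heights b \<and> line d b = c \<and> height_adj a z b w} = (if line d a = c then q\<^sup>2 - 1 else q)"
    using card_height_adj[OF z, of "\<lambda>b _. line d b = c"] card_isotropic_on_line[OF d, of a c]
    by (simp add: conj_commute conj_left_commute)
  thus ?thesis using near by (simp add: card_vertices_split)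
qed

text \<open>There are \<open>q + 1\<close>, \<open>1\<close> or \<open>0\<close> net lines through
  both \<open>a\<close> and \<open>b\<close>, according as \<open>a = b\<close>, \<open>a\<close>
  and \<open>b\<close> are joined, or neither. In each case this is exactly the number that the
  common neighbours at heights fall short of the expected one, so the lines enter only through the
  relation of being joined.\<close>

lemma common_Far_Far:
  assumes z: "z \<in> heights a" and w: "w \<in> heights b" and ne: "(a, z) \<noteq> (b, w)"
  shows "common (Far a z) (Far b w) = expected (Far a z) (Far b w)"
proof -
  have near: "card {(d, c). d \<in> directions \<and> line d a = c \<and> line d b = c} = 
      (if a = b then q + 1 else if isotropic (a - b) then 1 else 0)"
  proof -
    have "{d \<in> directions. line d b = line d a} = {d \<in> directions. line d a = line d b}"
      by (intro Collect_cong conj_cong refl) (rule eq_commute)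
    thus ?thesis using card_lines_joining[of a b] by (simp only: card_classes_through)
  qed
  have "1 + (q\<^sup>2 - 2) = q\<^sup>2 - 1"
    using q_sq_ge_2 by simp
  moreover have "a \<noteq> b \<and> isotropic (a - b)" if "height_adj a z b w"
    using that height_adj_iff[OF z, of w b] w by auto
  ultimately show ?thesis
    using card_common_height_adj[OF z w ne] near by (simp add: card_vertices_split)
qed

lemma common_eq_expected:
  assumes "x \<in> vertices" "y \<in> vertices" "x \<noteq> y"
  shows "common x y = expected x y"
proof -
  have sym: "common x y = common y x" "expected x y = expected y x" for x y
    by (simp_all add: conj_commute vadj_sym[of x y])
  show ?thesis
  proof (cases x)
    case Apex
    thus ?thesis using assms common_Apex_Near common_Apex_Far by (cases y) auto
  next
    case x: (Near d c)
    thus ?thesis using assms common_Apex_Near[of d c] common_Near_Near common_Near_Far sym[of x y] 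
      by (cases y) auto
  next
    case x: (Far a z)
    thus ?thesis using assms common_Apex_Far[of a z] common_Near_Far[of _ z a] common_Far_Far sym[of x y] 
      by (cases y) auto
  qed
qed

theorem srg_net_graph: "srg net_graph (card vertices) (q\<^sup>2 * (q + 1)) (q\<^sup>2 - 1) (q + 1)"
proof -
  have nbrs: "nbrs net_graph x = {v \<in> vertices. vadj x v}" if "x \<in> vertices" for x
    using that by (auto simp: nbrs_def net_graph_def)
  have "pair_graph net_graph"
    by (rule pair_graphI) (auto simp: net_graph_def finite_vertices not_vadj_self vadj_sym)
  moreover have "q\<^sup>2 * (q + 1) + 1 < card vertices"
  proof -
    have far: "Far 0 0 \<in> vertices" by (simp add: heights_def skew_form_def)
    have "q\<^sup>2 * (q + 1) + 1 < card (insert (Far 0 0) (insert Apex {v \<in> vertices. vadj Apex v}))"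
      using degree[of Apex] finite_vertices by (simp add: card_insert_if)
    also have "\<dots> \<le> card vertices"
      by (rule card_mono) (use finite_vertices far in auto)
    finally show ?thesis .
  qed
  moreover have "nbrs net_graph x \<inter> nbrs net_graph y = {v \<in> vertices. vadj x v \<and> vadj y v}" 
    if "x \<in> vertices" "y \<in> vertices" for x y using nbrs that by auto
  ultimately show ?thesis
    using degree common_eq_expected nbrs q_gt_1 by (auto simp: srg_def net_graph_def)
qed

end

section \<open>The transposed net\<close>

context hermitian_field
begin

text \<open>Coordinates of \<open>x\<close> in the basis \<open>1, \<theta>\<close> of
  \<open>K\<close> over its fixed field.\<close>

definition im :: "'a \<Rightarrow> 'a \<Rightarrow> 'a" where "im \<theta> x = (x - cj x) / (\<theta> - cj \<theta>)"
definition re :: "'a \<Rightarrow> 'a \<Rightarrow> 'a" where "re \<theta> x = x - im \<theta> x * \<theta>"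

text \<open>Transposition of the \<open>2 \<times> 2\<close> matrix over the fixed field with
  columns the coordinates of \<open>fst a\<close> and of \<open>snd a\<close>.\<close>

definition transpose :: "'a \<Rightarrow> 'a \<times> 'a \<Rightarrow> 'a \<times> 'a" where
  "transpose \<theta> a = (re \<theta> (fst a) + re \<theta> (snd a) * \<theta>, im \<theta> (fst a) + im \<theta> (snd a) * \<theta>)"

lemma re_im_unique:
  assumes \<theta>: "cj \<theta> \<noteq> \<theta>" and "cj s = s" "cj t = t"
  shows "im \<theta> (s + t * \<theta>) = t" "re \<theta> (s + t * \<theta>) = s"
proof -
  have "s + t * \<theta> - cj (s + t * \<theta>) = t * (\<theta> - cj \<theta>)"
    using assms by (simp add: cj_simps algebra_simps)
  thus "im \<theta> (s + t * \<theta>) = t" using \<theta> by (simp add: im_def)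
  thus "re \<theta> (s + t * \<theta>) = s" by (simp add: re_def)
qed

lemma re_im_decomp:
  assumes \<theta>: "cj \<theta> \<noteq> \<theta>"
  shows "cj (im \<theta> x) = im \<theta> x" "cj (re \<theta> x) = re \<theta> x" "x = re \<theta> x + im \<theta> x * \<theta>"
proof -
  have nz: "\<theta> - cj \<theta> \<noteq> 0" using \<theta> by simp
  have "cj (im \<theta> x) = (cj x - x) / (cj \<theta> - \<theta>)" by (simp add: im_def cj_simps)
  also have "\<dots> = im \<theta> x" unfolding im_def by (metis minus_diff_eq minus_divide_divide)
  finally show im: "cj (im \<theta> x) = im \<theta> x" .
  have "x - cj x = im \<theta> x * (\<theta> - cj \<theta>)" using nz by (simp add: im_def)
  thus "cj (re \<theta> x) = re \<theta> x" by (simp add: re_def cj_simps im algebra_simps)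
  show "x = re \<theta> x + im \<theta> x * \<theta>" by (simp add: re_def)
qed

lemma im_diff: "im \<theta> (x - y) = im \<theta> x - im \<theta> y"
  by (simp add: im_def cj_simps algebra_simps flip: diff_divide_distrib)

lemma re_diff: "re \<theta> (x - y) = re \<theta> x - re \<theta> y"
  by (simp add: re_def im_diff algebra_simps)

lemma transpose_diff: "transpose \<theta> (a - b) = transpose \<theta> a - transpose \<theta> b"
  by (simp add: transpose_def re_diff im_diff algebra_simps)

lemma transpose_transpose:
  assumes "cj \<theta> \<noteq> \<theta>" shows "transpose \<theta> (transpose \<theta> a) = a"
  using re_im_decomp[OF assms, of "fst a"] re_im_decomp[OF assms, of "snd a"]
  by (simp add: transpose_def re_im_unique[OF assms])

text \<open>Up to the factor \<open>cj \<theta> - \<theta>\<close>, the value \<open>skew_form a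
  a\<close> is the determinant of the matrix.\<close>

lemma skew_form_transpose:
  assumes \<theta>: "cj \<theta> \<noteq> \<theta>" shows "skew_form (transpose \<theta> a) (transpose \<theta> a) = skew_form a a"
proof -
  have det: "skew_form (x1 + x2 * \<theta>, y1 + y2 * \<theta>) (x1 + x2 * \<theta>, y1 + y2 * \<theta>) = 
      (x2 * y1 - x1 * y2) * (\<theta> - cj \<theta>)"
    if "cj x1 = x1" "cj x2 = x2" "cj y1 = y1" "cj y2 = y2" for x1 x2 y1 y2
    using that by (simp add: skew_form_def cj_simps algebra_simps)
  note x = re_im_decomp[OF \<theta>, of "fst a"] and y = re_im_decomp[OF \<theta>, of "snd a"]
  have "skew_form (transpose \<theta> a) (transpose \<theta> a) = 
      (re \<theta> (snd a) * im \<theta> (fst a) - re \<theta> (fst a) * im \<theta> (snd a)) * (\<theta> - cj \<theta>)"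
    unfolding transpose_def by (rule det) (use x y in auto)
  also have "\<dots> = (im \<theta> (fst a) * re \<theta> (snd a) - re \<theta> (fst a) * im \<theta> (snd a)) * (\<theta> - cj \<theta>)"
    by (simp add: mult.commute)
  also have "\<dots> = skew_form (re \<theta> (fst a) + im \<theta> (fst a) * \<theta>, re \<theta> (snd a) + im \<theta> (snd a) * \<theta>) 
      (re \<theta> (fst a) + im \<theta> (fst a) * \<theta>, re \<theta> (snd a) + im \<theta> (snd a) * \<theta>)"
    by (rule det[symmetric]) (use x y in auto)
  also have "\<dots> = skew_form a a" by (simp flip: x(3) y(3))
  finally show ?thesis .
qed

text \<open>Transposition is an additive involution that preserves isotropy, so it carries the net
  axioms over from the affine lines.\<close>

lemma transposed_net:
  assumes \<theta>: "cj \<theta> \<noteq> \<theta>" shows "net q (\<lambda>d a. intercept d (transpose \<theta> a))"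
proof
  note tt = transpose_transpose[OF \<theta>]
  show "\<exists>!a. intercept d (transpose \<theta> a) = c \<and> intercept d' (transpose \<theta> a) = c'" 
    if d: "d \<in> directions" "d' \<in> directions" "d \<noteq> d'" for d d' c c'
  proof -
    obtain a0 where a0: "intercept d a = c \<and> intercept d' a = c' \<longleftrightarrow> a = a0" for a
      using std.meet[OF d, of c c'] by metis
    have "transpose \<theta> a = a0 \<longleftrightarrow> a = transpose \<theta> a0" for a using tt by metis
    thus ?thesis by (simp add: a0)
  qed
  show "isotropic (a - b) \<longleftrightarrow> (\<exists>d\<in>directions. intercept d (transpose \<theta> a) = intercept d (transpose \<theta> b))" 
    if "a \<noteq> b" for a b
  proof -
    have "transpose \<theta> a \<noteq> transpose \<theta> b" using tt that by metis
    from std.joined[OF this] show ?thesis 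
      by (simp only: transpose_diff[symmetric] skew_form_transpose[OF \<theta>])
  qed
qed

text \<open>The transposed line through the origin in direction \<open>None\<close> consists of
  the pairs \<open>(s * \<theta>, t * \<theta>)\<close> with \<open>s\<close> and \<open>t\<close>
  fixed by \<open>cj\<close>. It contains the points \<open>(\<theta>, 0)\<close> and \<open>(0,
  \<theta>)\<close>, which lie in different isotropic directions from the origin.\<close>

theorem ex_net_graph_with_nonclique:
  obtains line x y w w' where "net q (line :: 'a option \<Rightarrow> 'a \<times> 'a \<Rightarrow> 'a)"
    "(x, y) \<in> parcs (net.net_graph q line)" 
    "w \<in> nbrs (net.net_graph q line) x \<inter> nbrs (net.net_graph q line) y"
    "w' \<in> nbrs (net.net_graph q line) x \<inter> nbrs (net.net_graph q line) y"
    "w \<noteq> w'" "(w, w') \<notin> parcs (net.net_graph q line)"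
proof -
  obtain \<theta> where \<theta>: "cj \<theta> \<noteq> \<theta>" using ex_not_fixed .
  hence \<theta>0: "\<theta> \<noteq> 0" by auto
  interpret T: net q K "\<lambda>d a. intercept d (transpose \<theta> a)" using transposed_net[OF \<theta>] .
  have \<theta>_coords: "re \<theta> \<theta> = 0" "im \<theta> \<theta> = 1" "re \<theta> 0 = 0" "im \<theta> 0 = 0"
    using re_im_unique[OF \<theta>, of 0 1] re_im_unique[OF \<theta>, of 0 0] by simp_all
  have tr: "transpose \<theta> (0, 0) = (0, 0)" "transpose \<theta> (\<theta>, 0) = (0, 1)" "transpose \<theta> (0, \<theta>) = (0, \<theta>)"
    by (simp_all add: transpose_def \<theta>_coords)
  have None: "None \<in> directions" by (simp add: directions_def)
  have intercept_None: "intercept None (0, x) = 0" for x by (simp add: intercept_def)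
  note defs = T.net_graph_def nbrs_def heights_def skew_form_def height_adj_def tr intercept_None None \<theta>0
  show thesis
    by (rule that[OF T.net_axioms, of "Near None 0" "Far (0, 0) 0" "Far (\<theta>, 0) 0" "Far (0, \<theta>) 0"])
       (simp_all add: defs)
qed

end

section \<open>Symplectic bases of Hermitian spaces\<close>

no_notation Matrix.vec_index (infixl \<open>$\<close> 100)

locale hermitian_space = hermitian_field q K for q and K :: "'a::{field,finite} itself" +
  fixes A :: "'a^4^4"
  assumes hermitian_A: "hermitian_matrix q A" and invertible_A: "invertible A"
begin

abbreviation herm :: "'a^4 \<Rightarrow> 'a^4 \<Rightarrow> 'a" where "herm \<equiv> hermitian_form q A"

lemma herm_eq: "herm u v = (\<Sum>i\<in>UNIV. \<Sum>j\<in>UNIV. A $ i $ j * u $ i * cj (v $ j))"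
  by (simp add: hermitian_form_def cj_def)

lemma herm_add_left: "herm (u + u') v = herm u v + herm u' v"
  by (simp add: herm_eq algebra_simps sum.distrib)

lemma herm_scale_left: "herm (c *s u) v = c * herm u v"
  by (simp add: herm_eq sum_distrib_left mult_ac)

lemma cj_sum: "cj (\<Sum>x\<in>X. g x) = (\<Sum>x\<in>X. cj (g x))"
  by (induction X rule: infinite_finite_induct) (auto simp: cj_add)

lemma cj_herm: "cj (herm u v) = herm v u"
proof -
  have A: "cj (A $ i $ j) = A $ j $ i" for i j
    unfolding cj_def using hermitian_A[unfolded hermitian_matrix_def, rule_format, of j i] by (rule sym)
  have "cj (herm u v) = (\<Sum>i\<in>UNIV. \<Sum>j\<in>UNIV. A $ j $ i * v $ j * cj (u $ i))"
    by (simp add: herm_eq cj_sum cj_mult A mult_ac)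
  also have "\<dots> = herm v u" unfolding herm_eq by (rule sum.swap)
  finally show ?thesis .
qed

lemma herm_add_right: "herm u (v + v') = herm u v + herm u v'"
  by (metis cj_herm cj_add herm_add_left)

lemma herm_scale_right: "herm u (c *s v) = cj c * herm u v"
  by (metis cj_herm cj_mult herm_scale_left)

lemma herm_diff_left: "herm (u - u') v = herm u v - herm u' v"
  using herm_add_left[of "u - u'" u' v] by simp

lemma herm_0 [simp]: "herm 0 v = 0" "herm v 0 = 0"
  using herm_scale_left[of 0 0 v] herm_scale_right[of v 0 0] by simp_all

lemma herm_eq_0_commute: "herm u v = 0 \<longleftrightarrow> herm v u = 0"
  by (metis cj_herm cj_eq_0_iff)

lemmas herm_simps = herm_add_left herm_add_right herm_scale_left herm_scale_right

lemma nondegenerate: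
  assumes "\<And>v. herm u v = 0" shows "u = 0"
proof -
  have "(u v* A) $ j = 0" for j
  proof -
    have "herm u (axis j 1) = (\<Sum>i\<in>UNIV. \<Sum>k\<in>UNIV. if k = j then u $ i * A $ i $ k else 0)"
      unfolding herm_eq by (intro sum.cong refl) (auto simp: axis_def mult_ac)
    also have "\<dots> = (u v* A) $ j" by (simp add: vector_matrix_mult_def)
    finally show ?thesis using assms by simp
  qed
  hence "u v* A = 0" by (simp add: Finite_Cartesian_Product.vec_eq_iff)
  obtain A' where A': "A ** A' = Finite_Cartesian_Product.mat 1"
    using invertible_A unfolding invertible_def by blast
  have "u = (u v* A) v* A'" by (simp add: vector_matrix_mul_assoc A')
  thus ?thesis by (simp add: \<open>u v* A = 0\<close>)
qed

text \<open>A subspace with more than \<open>q\<^sup>2\<close> vectors contains two independent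
  ones. If an orthogonal pair \<open>u, v\<close> is anisotropic, then \<open>v + x u\<close> is
  isotropic for some \<open>x\<close>, because \<open>- herm v v / herm u u\<close> is a
  norm.\<close>

lemma ex_isotropic:
  assumes W: "vec.subspace W" "q\<^sup>2 < card W"
  obtains e where "e \<in> W" "e \<noteq> 0" "herm e e = 0"
proof -
  have small: "\<exists>w\<in>W. w \<notin> range (\<lambda>c. c *s u)" for u
  proof -
    have "card (range (\<lambda>c. c *s u)) \<le> q\<^sup>2"
      using card_image_le[of UNIV "\<lambda>c. c *s u"] by (simp add: card_field)
    hence "\<not> W \<subseteq> range (\<lambda>c. c *s u)" using W(2) by (metis card_mono finite finite_imageI leD le_trans)
    thus ?thesis by blast
  qed
  obtain u where u: "u \<in> W" "u \<noteq> 0" using small[of 0] by auto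
  show thesis
  proof (cases "herm u u = 0")
    case True thus thesis using that u by blast
  next
    case fu: False
    obtain w where w: "w \<in> W" "w \<notin> range (\<lambda>c. c *s u)" using small by blast
    define v where "v = w - (herm w u / herm u u) *s u"
    have v: "v \<in> W" "v \<noteq> 0" "herm v u = 0"
      using w u W(1) fu by (auto simp: v_def vec.subspace_diff vec.subspace_scale herm_diff_left herm_scale_left)
    hence uv: "herm u v = 0" by (simp add: herm_eq_0_commute)
    have "cj (- herm v v / herm u u) = - herm v v / herm u u" by (simp add: cj_simps cj_herm)
    then obtain x where x: "x * cj x = - herm v v / herm u u" using norm_surj by blast
    define e where "e = v + x *s u"
    have fe: "herm e u = x * herm u u" "herm e e = herm v v + (x * cj x) * herm u u"
      by (simp_all add: e_def herm_simps v uv)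
    have "herm e e = 0" unfolding fe x using fu by simp
    moreover have "e \<noteq> 0"
    proof
      assume "e = 0"
      hence "x = 0" using fe(1) fu by simp
      thus False using \<open>e = 0\<close> v by (simp add: e_def)
    qed
    moreover have "e \<in> W" using v u W(1) by (simp add: e_def vec.subspace_add vec.subspace_scale)
    ultimately show thesis using that by blast
  qed
qed

lemma ex_hyperbolic_pair:
  assumes W: "vec.subspace W" "q\<^sup>2 < card W" 
    and nondeg: "\<And>u. u \<in> W \<Longrightarrow> (\<And>v. v \<in> W \<Longrightarrow> herm u v = 0) \<Longrightarrow> u = 0" and \<kappa>: "\<kappa> \<noteq> 0"
  obtains e e' where "e \<in> W" "e' \<in> W" "herm e e = 0" "herm e' e' = 0" "herm e e' = \<kappa>"
proof -
  obtain e where e: "e \<in> W" "e \<noteq> 0" "herm e e = 0" using ex_isotropic[OF W] .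
  obtain w where w: "w \<in> W" "herm e w \<noteq> 0" using nondeg e by blast
  define w1 where "w1 = cj (\<kappa> / herm e w) *s w"
  have w1: "w1 \<in> W" "herm e w1 = \<kappa>" using w W(1) by (auto simp: w1_def herm_simps vec.subspace_scale)
  hence w1e: "herm w1 e = cj \<kappa>" by (metis cj_herm)
  have "cj (- herm w1 w1) = - herm w1 w1" by (simp add: cj_simps cj_herm)
  then obtain x where x: "x + cj x = - herm w1 w1" using trace_surj by blast
  define e' where "e' = w1 + (x / \<kappa>) *s e"
  have "herm e' e' = herm w1 w1 + (x + cj x)"
    using \<kappa> by (simp add: e'_def herm_simps e w1 w1e cj_simps)
  hence "herm e' e' = 0" by (simp add: x)
  moreover have "herm e e' = \<kappa>" by (simp add: e'_def herm_simps e w1)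
  moreover have "e' \<in> W" using e w1 W(1) by (simp add: e'_def vec.subspace_add vec.subspace_scale)
  ultimately show thesis using that e by blast
qed

lemma card_space: "CARD('a^4) = q ^ 8"
  by (simp add: card_field flip: power_mult)

text \<open>Split off a hyperbolic pair from the whole space, and then a second one from its
  orthogonal complement, which is nondegenerate and, by counting, large enough.\<close>

lemma ex_symplectic_basis:
  assumes \<kappa>: "\<kappa> \<noteq> 0"
  obtains e0 e1 e2 e3 where 
    "herm e0 e0 = 0" "herm e1 e1 = 0" "herm e2 e2 = 0" "herm e3 e3 = 0" "herm e0 e3 = \<kappa>" "herm e1 e2 = \<kappa>"
    "herm e0 e1 = 0" "herm e0 e2 = 0" "herm e1 e3 = 0" "herm e2 e3 = 0"
proof -
  have "q\<^sup>2 < card (UNIV :: ('a^4) set)"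
    unfolding card_space using q_gt_1 by (intro power_strict_increasing) auto
  then obtain e0 e3 where e: "herm e0 e0 = 0" "herm e3 e3 = 0" "herm e0 e3 = \<kappa>"
    using ex_hyperbolic_pair[OF vec.subspace_UNIV _ _ \<kappa>] nondegenerate by (metis UNIV_I)
  hence e30: "herm e3 e0 = cj \<kappa>" by (metis cj_herm)
  define W where "W = {v. herm v e0 = 0 \<and> herm v e3 = 0}"
  define \<pi> where "\<pi> v = v - ((herm v e3 / \<kappa>) *s e0 + (herm v e0 / cj \<kappa>) *s e3)" for v
  have \<pi>: "\<pi> v \<in> W" for v
    using \<kappa> by (simp add: W_def \<pi>_def herm_diff_left herm_simps e e30)
  have decomp: "v = \<pi> v + ((herm v e3 / \<kappa>) *s e0 + (herm v e0 / cj \<kappa>) *s e3)" for v by (simp add: \<pi>_def)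
  have sub: "vec.subspace W"
    by (auto simp: vec.subspace_def W_def herm_simps)
  have "inj (\<lambda>v. (\<pi> v, herm v e3, herm v e0))"
    by (rule injI) (metis Pair_inject decomp)
  hence "card (UNIV :: ('a^4) set) \<le> card (W \<times> (UNIV :: 'a set) \<times> (UNIV :: 'a set))"
    by (rule card_inj_on_le) (use \<pi> in auto)
  hence "q ^ 4 * q ^ 4 \<le> card W * q ^ 4"
    by (simp add: card_space card_cartesian_product card_field flip: power_add)
  hence "q ^ 4 \<le> card W"
    by (rule mult_right_le_imp_le) (use q_gt_1 in simp)
  moreover have "q\<^sup>2 < q ^ 4" using q_gt_1 by (intro power_strict_increasing) auto
  ultimately have cardW: "q\<^sup>2 < card W" by simp
  have nondeg: "u = 0" if u: "u \<in> W" and orth: "\<And>v. v \<in> W \<Longrightarrow> herm u v = 0" for u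
  proof (rule nondegenerate)
    fix v
    have "herm u v = herm u (\<pi> v) + (cj (herm v e3 / \<kappa>) * herm u e0 + cj (herm v e0 / cj \<kappa>) * herm u e3)"
      by (subst decomp[of v]) (simp only: herm_simps)
    thus "herm u v = 0" using u orth[OF \<pi>[of v]] by (simp add: W_def)
  qed
  obtain e1 e2 where e12: "e1 \<in> W" "e2 \<in> W" "herm e1 e1 = 0" "herm e2 e2 = 0" "herm e1 e2 = \<kappa>"
    using ex_hyperbolic_pair[OF sub cardW nondeg \<kappa>] by blast
  have "herm e1 e0 = 0" "herm e2 e0 = 0" "herm e1 e3 = 0" "herm e2 e3 = 0" using e12 by (auto simp: W_def)
  moreover from this have "herm e0 e1 = 0" "herm e0 e2 = 0" by (simp_all add: herm_eq_0_commute[of e0])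
  ultimately show thesis using that e e12 by blast
qed

end

section \<open>The Hermitian quadrangle in coordinates\<close>

context hermitian_space
begin

text \<open>Polarization: were \<open>t = herm u v\<close> nonzero, then the value of the form at
  \<open>u + (d * t) v\<close> would be \<open>d + cj d\<close> times the norm of
  \<open>t\<close>, which is nonzero for an element \<open>d\<close> of trace one.\<close>

lemma herm_eq_0_if_totally_isotropic:
  assumes L: "vec.subspace L" "L \<subseteq> hermitian_cone q A" and uv: "u \<in> L" "v \<in> L"
  shows "herm u v = 0"
proof (rule ccontr)
  assume nz: "herm u v \<noteq> 0"
  have iso: "herm x x = 0" if "x \<in> L" for x using L(2) that by (auto simp: hermitian_cone_def)
  obtain d where d: "d + cj d = 1" using trace_surj[of 1] by auto
  let ?c = "d * herm u v"
  have "u + ?c *s v \<in> L" using L(1) uv by (intro vec.subspace_add vec.subspace_scale)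
  hence "0 = herm (u + ?c *s v) (u + ?c *s v)" by (simp add: iso)
  also have "\<dots> = cj ?c * herm u v + ?c * herm v u" by (simp add: herm_simps iso uv)
  also have "\<dots> = (d + cj d) * (herm u v * cj (herm u v))" by (simp add: cj_mult cj_herm algebra_simps)
  finally show False using nz by (simp add: d)
qed

lemma collinear_iff_orthogonal:
  assumes u: "u \<noteq> 0" "herm u u = 0" and v: "v \<noteq> 0" "herm v v = 0" and ne: "vec.span {u} \<noteq> vec.span {v}"
  shows "collinear_in (hermitian_GQ q A) (vec.span {u}) (vec.span {v}) \<longleftrightarrow> herm u v = 0"
proof
  assume "collinear_in (hermitian_GQ q A) (vec.span {u}) (vec.span {v})"
  then obtain L where "vec.subspace L" "L \<subseteq> hermitian_cone q A" "vec.span {u} \<subseteq> L" "vec.span {v} \<subseteq> L"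
    by (auto simp: collinear_in_def hermitian_GQ_def)
  thus "herm u v = 0" 
    by (intro herm_eq_0_if_totally_isotropic) (auto intro: subsetD vec.span_base)
next
  assume uv: "herm u v = 0"
  hence vu: "herm v u = 0" by (simp add: herm_eq_0_commute)
  have "u \<notin> vec.span {v}"
  proof
    assume "u \<in> vec.span {v}"
    then obtain k where k: "u = k *s v" by (auto simp: vec.span_singleton)
    hence "k \<noteq> 0" using u by auto
    hence "v = inverse k *s u" by (simp add: k)
    hence "v \<in> vec.span {u}" by (auto simp: vec.span_singleton)
    hence "vec.span {v} \<subseteq> vec.span {u}" by (intro vec.span_minimal) auto
    moreover have "vec.span {u} \<subseteq> vec.span {v}" using \<open>u \<in> vec.span {v}\<close> by (intro vec.span_minimal) auto
    ultimately show False using ne by blast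
  qed
  hence "vec.dim (vec.span {u, v}) = 2" using v by (simp add: vec.dim_insert)
  moreover have "vec.span {u, v} \<subseteq> hermitian_cone q A"
  proof
    fix x assume "x \<in> vec.span {u, v}"
    then obtain k l where "x - k *s u = l *s v" by (auto simp: vec.span_insert[of u] vec.span_singleton)
    hence x: "x = k *s u + l *s v" by (simp add: algebra_simps)
    show "x \<in> hermitian_cone q A" unfolding hermitian_cone_def x by (simp add: herm_simps u v uv vu)
  qed
  ultimately have "vec.span {u, v} \<in> lns (hermitian_GQ q A)" by (simp add: hermitian_GQ_def)
  moreover have "vec.span {u} \<subseteq> vec.span {u, v}" "vec.span {v} \<subseteq> vec.span {u, v}"
    by (auto intro!: vec.span_mono)
  ultimately show "collinear_in (hermitian_GQ q A) (vec.span {u}) (vec.span {v})"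
    by (auto simp: collinear_in_def hermitian_GQ_def)
qed

end

text \<open>Taking the nonzero entries of the Gram matrix to be a skew element
  \<open>\<kappa>\<close> turns the Hermitian form into \<open>\<kappa>\<close> times the
  skew-Hermitian form \<open>form\<close>, which extends \<open>skew_form\<close>.\<close>

locale symplectic_basis = hermitian_space q K A for q and K :: "'a::{field,finite} itself" and A +
  fixes \<kappa> :: 'a and e0 e1 e2 e3 :: "'a^4"
  assumes \<kappa>: "cj \<kappa> = - \<kappa>" "\<kappa> \<noteq> 0"
    and gram: "herm e0 e0 = 0" "herm e1 e1 = 0" "herm e2 e2 = 0" "herm e3 e3 = 0" "herm e0 e3 = \<kappa>" "herm e1 e2 = \<kappa>"
      "herm e0 e1 = 0" "herm e0 e2 = 0" "herm e1 e3 = 0" "herm e2 e3 = 0"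
begin

lemma gram_transposed: "herm e3 e0 = - \<kappa>" "herm e2 e1 = - \<kappa>" "herm e1 e0 = 0" "herm e2 e0 = 0" "herm e3 e1 = 0" "herm e3 e2 = 0"
proof -
  show "herm e3 e0 = - \<kappa>" "herm e2 e1 = - \<kappa>" 
    using cj_herm[of e0 e3] cj_herm[of e1 e2] by (simp_all only: gram \<kappa>)
  show "herm e1 e0 = 0" "herm e2 e0 = 0" "herm e3 e1 = 0" "herm e3 e2 = 0"
    by (rule herm_eq_0_commute[THEN iffD1], rule gram)+
qed

definition combine :: "'a \<times> ('a \<times> 'a) \<times> 'a \<Rightarrow> 'a^4" where
  "combine = (\<lambda>(h, a, z). h *s e0 + fst a *s e1 + snd a *s e2 + z *s e3)"

definition form :: "'a \<times> ('a \<times> 'a) \<times> 'a \<Rightarrow> 'a \<times> ('a \<times> 'a) \<times> 'a \<Rightarrow> 'a" where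
  "form = (\<lambda>(h, a, z) (k, b, w). h * cj w - z * cj k + skew_form a b)"

definition scale_coords :: "'a \<Rightarrow> 'a \<times> ('a \<times> 'a) \<times> 'a \<Rightarrow> 'a \<times> ('a \<times> 'a) \<times> 'a" where
  "scale_coords \<mu> = (\<lambda>(h, a, z). (\<mu> * h, scale \<mu> a, \<mu> * z))"

lemma herm_combine: "herm (combine c) (combine d) = \<kappa> * form c d"
  by (cases c; cases d) 
     (simp add: combine_def form_def skew_form_def herm_simps gram gram_transposed algebra_simps)

lemma combine_scale: "combine (scale_coords \<mu> c) = \<mu> *s combine c"
  by (cases c) (simp add: combine_def scale_coords_def scale_def vec.scale_right_distrib)

lemma inj_combine: "inj combine"
proof (rule injI)
  fix c d assume eq: "combine c = combine d"
  obtain h a z k b w where cd: "c = (h, a, z)" "d = (k, b, w)" by (cases c; cases d)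
  have "herm (combine c) e = herm (combine d) e" for e by (simp add: eq)
  from this[of e0] this[of e1] this[of e2] this[of e3] 
  show "c = d" using \<kappa> by (simp add: cd combine_def herm_simps gram gram_transposed prod_eq_iff)
qed

lemma surj_combine: "surj combine"
proof -
  have "card (range combine) = CARD('a \<times> ('a \<times> 'a) \<times> 'a)" by (rule card_image[OF inj_combine])
  also have "\<dots> = CARD('a^4)"
    by (simp add: card_space card_field flip: power_add)
  finally show ?thesis by (intro card_subset_eq) auto
qed

lemma combine_eq_0_iff: "combine c = 0 \<longleftrightarrow> c = (0, (0, 0), 0)"
proof -
  have "combine (0, (0, 0), 0) = 0" by (simp add: combine_def)
  thus ?thesis using inj_combine by (metis injD)
qed

text \<open>Normalized coordinate vectors of the points. The base point is the last basis vector;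
  \<open>cj c\<close> in the second equation makes orthogonality to \<open>(1, a, z)\<close>
  equivalent to \<open>intercept d a = c\<close>.\<close>

fun coords :: "'a vertex \<Rightarrow> 'a \<times> ('a \<times> 'a) \<times> 'a" where
  "coords Apex = (0, (0, 0), 1)"
| "coords (Near d c) = (0, dir_vec d, cj c)"
| "coords (Far a z) = (1, a, z)"

lemma dir_vec_nonzero: "dir_vec d \<noteq> (0, 0)"
  by (cases d) (auto simp: dir_vec_def)

lemma coords_nonzero: "coords x \<noteq> (0, (0, 0), 0)"
  by (cases x) (auto simp: dir_vec_nonzero)

lemma skew_form_0 [simp]: "skew_form (0, 0) a = 0" "skew_form a (0, 0) = 0"
  by (simp_all add: skew_form_def)

lemma form_coords_eq_0_iff:
  assumes "x \<in> vertices" "y \<in> vertices"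
  shows "form (coords x) (coords y) = 0 \<longleftrightarrow> x = y \<or> std.vadj x y"
proof -
  have near: "skew_form (dir_vec d) (dir_vec d') = 0 \<longleftrightarrow> d = d'" if "d \<in> directions" for d d'
  proof -
    have "intercept d (dir_vec d') = 0 \<longleftrightarrow> d = d'"
      using intercept_eq_0_unique[of d "dir_vec d'" d'] dir_vec_nonzero[of d'] intercept_dir_vec 
      by (auto simp: zero_prod_def)
    thus ?thesis using that by (simp add: skew_form_dir_vec)
  qed
  have near_far: "- cj c + skew_form (dir_vec d) a = 0 \<longleftrightarrow> intercept d a = c" 
    "cj (cj c) + skew_form a (dir_vec d) = 0 \<longleftrightarrow> intercept d a = c" if "d \<in> directions" for d c a
  proof -
    have *: "skew_form (dir_vec d) a = cj (intercept d a)" using that by (rule skew_form_dir_vec)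
    have "skew_form a (dir_vec d) = - intercept d a" using cj_skew_form[of "dir_vec d" a] by (simp add: *)
    thus "- cj c + skew_form (dir_vec d) a = 0 \<longleftrightarrow> intercept d a = c" 
      "cj (cj c) + skew_form a (dir_vec d) = 0 \<longleftrightarrow> intercept d a = c" 
      by (auto simp: * add_eq_0_iff)
  qed
  have far: "cj w - z + skew_form a b = 0 \<longleftrightarrow> Far a z = Far b w \<or> height_adj a z b w"
    if "z \<in> heights a" "w \<in> heights b" for a z b w
  proof (cases "a = b")
    case True
    have "cj w - z + skew_form a b = w - z - (w - cj w - skew_form b b)" using True by simp
    also have "\<dots> = w - z" using that by (simp add: heights_def)
    finally have "cj w - z + skew_form a b = w - z" .
    thus ?thesis unfolding height_adj_def using True by (simp only:) auto
  next
    case False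
    thus ?thesis by (auto simp: height_adj_def algebra_simps)
  qed
  show ?thesis
    using assms by (cases x; cases y) (auto simp: form_def near near_far[simplified] far)
qed

lemma coords_scale_unique:
  assumes "x \<in> vertices" "y \<in> vertices" "coords x = scale_coords \<mu> (coords y)"
  shows "x = y"
proof -
  have dir: "d = d' \<and> \<mu> = 1" if "dir_vec d = scale \<mu> (dir_vec d')" for d d'
    using that by (cases d; cases d') (auto simp: dir_vec_def scale_def)
  have zero: "(0, 0) = scale \<mu> (dir_vec d) \<longleftrightarrow> \<mu> = 0" for d
    by (cases d) (auto simp: dir_vec_def scale_def)
  have scale: "scale 0 a = (0, 0)" "scale \<mu> (0, 0) = (0, 0)" "scale 1 a = a" for a
    by (simp_all add: scale_def)
  show ?thesis
  proof (cases x)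
    case x: Apex
    show ?thesis
    proof (cases y)
      case (Near d c)
      have "(0, 0) = scale \<mu> (dir_vec d)" and *: "1 = \<mu> * cj c" 
        using assms(3) by (simp_all add: x Near scale_coords_def)
      hence "\<mu> = 0" by (simp only: zero)
      thus ?thesis using * by simp
    qed (use assms(3) x in \<open>auto simp: scale_coords_def\<close>)
  next
    case x: (Near d c)
    show ?thesis
    proof (cases y)
      case Apex
      thus ?thesis using assms(3) x dir_vec_nonzero[of d] by (simp add: scale_coords_def scale(2))
    next
      case (Near d' c')
      have "dir_vec d = scale \<mu> (dir_vec d')" and *: "cj c = \<mu> * cj c'" 
        using assms(3) by (simp_all add: x Near scale_coords_def)
      from dir[OF this(1)] show ?thesis using * by (simp add: x Near)
    next
      case (Far a z)
      have "\<mu> = 0" "dir_vec d = scale \<mu> a" using assms(3) by (simp_all add: x Far scale_coords_def)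
      thus ?thesis using dir_vec_nonzero[of d] by (simp add: scale(1))
    qed
  next
    case x: (Far a z)
    show ?thesis
      using assms(3) by (cases y) (auto simp: x scale_coords_def scale(3))
  qed
qed

lemma ex_vertex_coords:
  assumes "c \<noteq> (0, (0, 0), 0)" "form c c = 0"
  obtains x \<mu> where "x \<in> vertices" "\<mu> \<noteq> 0" "c = scale_coords \<mu> (coords x)"
proof -
  obtain h a z where c: "c = (h, a, z)" by (cases c)
  show thesis
  proof (cases "h = 0")
    case h: False
    define b w where "b = scale (inverse h) a" and "w = inverse h * z"
    hence bw: "a = scale h b" "z = h * w" using h by (simp_all add: scale_def prod_eq_iff)
    have "0 = form c c" using assms by simp
    also have "\<dots> = h * cj h * (cj w - w + skew_form b b)"
      by (simp add: c bw form_def skew_form_def scale_def cj_simps algebra_simps)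
    finally have "cj w - w + skew_form b b = 0" using h by simp
    hence "w \<in> heights b" by (simp add: heights_def algebra_simps)
    thus thesis using h by (intro that[of "Far b w" h]) (simp_all add: c bw scale_coords_def)
  next
    case h: True
    show thesis
    proof (cases "a = (0, 0)")
      case True
      thus thesis using assms(1) h
        by (intro that[of Apex z]) (auto simp: c scale_coords_def scale_def)
    next
      case False
      have "isotropic a" using assms(2) h by (simp add: c form_def)
      then obtain d \<mu> where d: "d \<in> directions" "a = scale \<mu> (dir_vec d)"
        by (auto simp: isotropic_iff_intercept intercept_eq_0_iff)
      hence "\<mu> \<noteq> 0" using False by (auto simp: scale_def)
      thus thesis using d h
        by (intro that[of "Near d (cj (z / \<mu>))" \<mu>]) (simp_all add: c scale_coords_def)
    qed
  qed
qed

definition point :: "'a vertex \<Rightarrow> ('a^4) set" where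
  "point x = vec.span {combine (coords x)}"

lemma bij_betw_point: "bij_betw point vertices (pts (hermitian_GQ q A))"
  unfolding bij_betw_def
proof
  show "inj_on point vertices"
  proof (rule inj_onI)
    fix x y assume xy: "x \<in> vertices" "y \<in> vertices" "point x = point y"
    have "combine (coords x) \<in> vec.span {combine (coords y)}"
      using xy(3) unfolding point_def by (metis singletonI vec.span_base)
    then obtain k where "combine (coords x) = k *s combine (coords y)" by (auto simp: vec.span_singleton)
    hence "coords x = scale_coords k (coords y)"
      using inj_combine by (metis combine_scale injD)
    thus "x = y" using coords_scale_unique xy by blast
  qed
  show "point ` vertices = pts (hermitian_GQ q A)"
  proof (intro equalityI subsetI)
    fix P assume "P \<in> point ` vertices"
    then obtain x where x: "x \<in> vertices" "P = point x" by blast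
    have "herm (combine (coords x)) (combine (coords x)) = 0"
      using x form_coords_eq_0_iff[of x x] by (simp add: herm_combine)
    hence "point x \<subseteq> hermitian_cone q A"
      by (auto simp: point_def vec.span_singleton hermitian_cone_def herm_simps)
    thus "P \<in> pts (hermitian_GQ q A)"
      using x coords_nonzero[of x] by (simp add: hermitian_GQ_def point_def combine_eq_0_iff)
  next
    fix P assume "P \<in> pts (hermitian_GQ q A)"
    hence P: "vec.subspace P" "vec.dim P = 1" "P \<subseteq> hermitian_cone q A" by (auto simp: hermitian_GQ_def)
    obtain B where B: "B \<subseteq> P" "vec.independent B" "P \<subseteq> vec.span B" "card B = 1"
      using vec.basis_exists[of P] P(2) by auto
    then obtain v where v: "B = {v}" by (auto simp: card_1_singleton_iff)
    have "v \<noteq> 0" using B(2) v by (auto simp: vec.dependent_zero)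
    have PB: "P = vec.span {v}" using B v P(1) by (metis subset_antisym vec.span_minimal)
    obtain c where c: "v = combine c" using surj_combine by (metis surjD)
    have "herm v v = 0" using P(3) B(1) v by (auto simp: hermitian_cone_def)
    hence "form c c = 0" using \<kappa> by (simp add: c herm_combine)
    moreover have "c \<noteq> (0, (0, 0), 0)" using \<open>v \<noteq> 0\<close> c combine_eq_0_iff by auto
    ultimately obtain x \<mu> where x: "x \<in> vertices" "\<mu> \<noteq> 0" "c = scale_coords \<mu> (coords x)"
      using ex_vertex_coords by blast
    have v': "v = \<mu> *s combine (coords x)" by (simp add: c x combine_scale)
    have "range (\<lambda>k. k *s v) = range (\<lambda>k. k *s combine (coords x))"
    proof (intro equalityI subsetI)
      fix y assume "y \<in> range (\<lambda>k. k *s combine (coords x))"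
      then obtain k where "y = k *s combine (coords x)" by blast
      hence "y = (k / \<mu>) *s v" using x by (simp add: v')
      thus "y \<in> range (\<lambda>k. k *s v)" by blast
    qed (auto simp: v')
    hence "P = point x" by (simp add: PB point_def vec.span_singleton)
    thus "P \<in> point ` vertices" using x by blast
  qed
qed

theorem srg_collinearity_graph:
  "srg (collinearity_graph (hermitian_GQ q A)) (card vertices) (q\<^sup>2 * (q + 1)) (q\<^sup>2 - 1) (q + 1)"
proof (rule srg_isomorphic[OF std.srg_net_graph, where f = point])
  let ?C = "collinearity_graph (hermitian_GQ q A)"
  show "bij_betw point (pverts std.net_graph) (pverts ?C)"
    using bij_betw_point by (simp add: std.net_graph_def collinearity_graph_def)
  show "parcs ?C \<subseteq> pverts ?C \<times> pverts ?C" by (auto simp: collinearity_graph_def)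
  show "(point x, point y) \<in> parcs ?C \<longleftrightarrow> (x, y) \<in> parcs std.net_graph"
    if "x \<in> pverts std.net_graph" "y \<in> pverts std.net_graph" for x y
  proof -
    have xy: "x \<in> vertices" "y \<in> vertices" using that by (simp_all add: std.net_graph_def)
    have pts: "point x \<in> pts (hermitian_GQ q A)" "point y \<in> pts (hermitian_GQ q A)"
      using bij_betw_point xy by (auto simp: bij_betw_def)
    have inj: "point x = point y \<longleftrightarrow> x = y"
      using bij_betw_point xy by (auto simp: bij_betw_def inj_on_eq_iff)
    have nz: "combine (coords x) \<noteq> 0" "combine (coords y) \<noteq> 0"
      using coords_nonzero combine_eq_0_iff by auto
    have iso: "herm (combine (coords x)) (combine (coords x)) = 0" "herm (combine (coords y)) (combine (coords y)) = 0"
      using xy by (simp_all add: herm_combine form_coords_eq_0_iff)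
    have "collinear_in (hermitian_GQ q A) (point x) (point y) \<longleftrightarrow> std.vadj x y" if "x \<noteq> y"
      unfolding point_def
      using collinear_iff_orthogonal[OF nz(1) iso(1) nz(2) iso(2)] that inj \<kappa> xy
      by (simp add: point_def herm_combine form_coords_eq_0_iff)
    thus ?thesis using xy pts inj std.not_vadj_self[of x]
      by (auto simp: collinearity_graph_def std.net_graph_def)
  qed
qed

end

section \<open>A cospectral graph that is not geometric\<close>

theorem proposition3p8:
  fixes q :: nat and A :: "'a::{field,finite}^4^4"
  assumes "primepow q"
    and "CARD('a) = q\<^sup>2"
    and "hermitian_matrix q A"
    and "invertible A"
  shows "\<exists>G :: nat pair_pre_digraph.
           strongly_regular G \<and>
           cospectral G (collinearity_graph (hermitian_GQ q A)) \<and>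
           \<not> geometric G"
proof -
  interpret hermitian_space q "TYPE('a)" A using assms by unfold_locales
  obtain \<theta> where \<theta>: "cj \<theta> \<noteq> \<theta>" using ex_not_fixed .
  define \<kappa> where "\<kappa> = \<theta> - cj \<theta>"
  have \<kappa>: "cj \<kappa> = - \<kappa>" "\<kappa> \<noteq> 0" using \<theta> by (simp_all add: \<kappa>_def cj_simps)
  obtain e0 e1 e2 e3 where "herm e0 e0 = 0" "herm e1 e1 = 0" "herm e2 e2 = 0" "herm e3 e3 = 0" "herm e0 e3 = \<kappa>" "herm e1 e2 = \<kappa>"
    "herm e0 e1 = 0" "herm e0 e2 = 0" "herm e1 e3 = 0" "herm e2 e3 = 0" using ex_symplectic_basis[OF \<kappa>(2)] .
  then interpret symplectic_basis q "TYPE('a)" A \<kappa> e0 e1 e2 e3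
    using \<kappa> by unfold_locales
  obtain line x y w w' where net: "net q (line :: 'a option \<Rightarrow> 'a \<times> 'a \<Rightarrow> 'a)" and
    xy: "(x, y) \<in> parcs (net.net_graph q line)" and
    w: "w \<in> nbrs (net.net_graph q line) x \<inter> nbrs (net.net_graph q line) y"
      "w' \<in> nbrs (net.net_graph q line) x \<inter> nbrs (net.net_graph q line) y" and
    ww': "w \<noteq> w'" "(w, w') \<notin> parcs (net.net_graph q line)"
    using ex_net_graph_with_nonclique .
  interpret N: net q "TYPE('a)" line by (rule net)
  obtain g :: "'a vertex \<Rightarrow> nat" where g: "inj_on g vertices"
    using finite_imp_inj_to_nat_seg[OF finite_vertices] by blast
  define G where "G = \<lparr>pverts = g ` vertices, parcs = map_prod g g ` parcs N.net_graph\<rparr>"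
  have arcs: "(g a, g b) \<in> parcs G \<longleftrightarrow> (a, b) \<in> parcs N.net_graph" if "a \<in> vertices" "b \<in> vertices" for a b
    using that g by (auto simp: G_def N.net_graph_def inj_on_eq_iff)
  have mem: "x \<in> vertices" "y \<in> vertices" "w \<in> vertices" "w' \<in> vertices"
    using xy w by (auto simp: N.net_graph_def nbrs_def)
  have srg: "srg G (card vertices) (q\<^sup>2 * (q + 1)) (q\<^sup>2 - 1) (q + 1)"
  proof (rule srg_isomorphic[OF N.srg_net_graph, where f = g])
    show "bij_betw g (pverts N.net_graph) (pverts G)" 
      using g by (simp add: G_def N.net_graph_def bij_betw_def)
    show "parcs G \<subseteq> pverts G \<times> pverts G" by (auto simp: G_def N.net_graph_def)
  qed (use arcs in \<open>simp add: N.net_graph_def\<close>)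
  have "\<not> geometric G"
  proof
    assume "geometric G"
    have "(g w, g w') \<in> parcs G"
    proof (rule geometric_imp_common_nbrs_adjacent[OF srg \<open>geometric G\<close>])
      show "(g x, g y) \<in> parcs G" using xy arcs mem by blast
      show "g w \<in> nbrs G (g x) \<inter> nbrs G (g y)" "g w' \<in> nbrs G (g x) \<inter> nbrs G (g y)"
        using w arcs mem by (simp_all add: nbrs_def) (simp_all add: G_def)
      show "g w \<noteq> g w'" using ww' mem g by (simp add: inj_on_eq_iff)
    qed
    thus False using arcs mem ww' by blast
  qed
  moreover have "strongly_regular G" using srg by (auto simp: strongly_regular_def)
  moreover have "cospectral G (collinearity_graph (hermitian_GQ q A))"
    using srg srg_collinearity_graph by (rule cospectral_if_srg_parameters_eq)
  ultimately show ?thesis by blast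
qed

end
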